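(* (1) Let $S\in\mathbb C$ and let $w:V\to\hat{\mathbb C}$ be a map on the vertices of the hexagonal lattice for which $S^{(1)}_{\mathfrak z}=S$ for all $\mathfrak z\in V$. Then the cross-ratios $T_i$ define a map $T:E\to\hat{\mathbb C}$ on the edges (the two cross-ratios assigned to an edge by its two adjacent hexagons coincide), and in every hexagon, with edges numbered cyclically $1,\dots,6$, they obey $$\frac{T_1}{T_4}=\frac{T_3}{T_6}=\frac{T_5}{T_2}=\frac{T_1+T_3-1-T_1T_2T_3}{1-T_2}.\qquad( * )$$ (2) Conversely, given a solution $T:E\to\hat{\mathbb C}$ of $( * )$, for each $S\in\mathbb C$ there is, up to Möbius transformations, a unique map $w:V\to\hat{\mathbb C}$ having the map $T$ as its cross-ratios on the edges and having $S^{(1)}_{\mathfrak z}=S$ for all $\mathfrak z\in V$. If the solution $T$ is real-negative, the resulting $w$ defines a hexagonal circle pattern with constant angles.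
   Context: Let $\omega=e^{2\pi i/3}$, $\varepsilon=e^{\pi i/3}$. The regular hexagonal lattice has vertex set $V=\{k+\ell\omega+m\omega^2: k,\ell,m\in\mathbb Z,\ k+\ell+m\not\equiv0\bmod 3\}$, edge set $E$ consisting of pairs of vertices at distance 1, and hexagonal faces centered at the points of $F=\{k+\ell\omega+m\omega^2:k+\ell+m\equiv0\bmod3\}$; the hexagon with center $\mathfrak z'\in F$ has vertices $\mathfrak z'+\varepsilon^k$, $k=1,\dots,6$. Edges are divided into classes $E_1,E_2,E_3$ according to whether the difference of the endpoints is $\pm1$, $\pm\omega$, $\pm\omega^2$. Cross-ratio: $q(z_1,z_2,z_3,z_4)=\dfrac{(z_2-z_1)(z_4-z_3)}{(z_3-z_2)(z_1-z_4)}$. For a map $w:V\to\hat{\mathbb C}$ and a hexagon with cyclically ordered vertices $\mathfrak z_1,\dots,\mathfrak z_6$, $w_i=w(\mathfrak z_i)$, the edge $[\mathfrak z_i,\mathfrak z_{i+1}]$ is assigned the cross-ratio $T_i=q(w_i,w_{i+1},w_{i+2},w_{i-1})$ (indices mod 6). For $\mathfrak z\in V$ let $\mathfrak z_1,\mathfrak z_2,\mathfrak z_3$ be its neighbors, counterclockwise ordered, with $[\mathfrak z_i,\mathfrak z]\in E_i$, and let $S^{(1)}_{\mathfrak z}=q(w(\mathfrak z_1),w(\mathfrak z_2),w(\mathfrak z),w(\mathfrak z_3))$. A map $w$ defines a hexagonal circle pattern if for each $\mathfrak z'\in F$ the points $w(\mathfrak z'+\varepsilon^k)$, $k=1,\dots,6$,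 lie on a circle $C(\mathfrak z')$ in this circular order. Circles of two hexagons with a common edge intersect at the images of the endpoints of that edge; the pattern has constant angles if the intersection angle of these two circles is constant on each of the classes $E_1,E_2,E_3$.
   Formalization: S=0 and S=1 are excluded: for T≡−2, a solution of ( * ), no map w has S=0 or 1, since T finite and ≠1 makes a vertex and its neighbors have distinct images. A solution T of ( * ) is finite and ≠1 on every edge, so ( * ) makes sense; a quotient 0/0 of opposite T's imposes no condition. *)

theory Defs
  imports "HOL-Analysis.Analysis"
begin

section \<open>The Riemann sphere, cross-ratios and Moebius transformations\<close>

datatype csphere = Fin (affine: complex) | Infty

text \<open>The point with homogeneous coordinates \<open>(x : y)\<close>. Where a quotient is formed below,
  \<open>(0 : 0)\<close> can only arise in a cross-ratio three of whose points coincide; it gets the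
  value \<^term>\<open>Infty\<close>.\<close>

definition proj_quot :: "complex \<Rightarrow> complex \<Rightarrow> csphere" where
  "proj_quot x y = (if y = 0 then Infty else Fin (x / y))"

text \<open>\<open>sdiff a b\<close> is the determinant of homogeneous coordinates of \<open>a\<close> and \<open>b\<close>. It is the
  difference \<open>a - b\<close> of finite points, and extends the cross-ratio to arguments at infinity:
  the two factors belonging to an infinite argument become \<open>1\<close> and \<open>-1\<close>, which is
  the limit of their quotient.\<close>

fun sdiff :: "csphere \<Rightarrow> csphere \<Rightarrow> complex" where
  "sdiff (Fin a) (Fin b) = a - b"
| "sdiff Infty (Fin b) = 1"
| "sdiff (Fin a) Infty = -1"
| "sdiff Infty Infty = 0"

definition cross_ratio :: "csphere \<Rightarrow> csphere \<Rightarrow> csphere \<Rightarrow> csphere \<Rightarrow> csphere" where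
  "cross_ratio z1 z2 z3 z4 =
     proj_quot (sdiff z2 z1 * sdiff z4 z3) (sdiff z3 z2 * sdiff z1 z4)"

fun moebius_map :: "complex \<Rightarrow> complex \<Rightarrow> complex \<Rightarrow> complex \<Rightarrow> csphere \<Rightarrow> csphere" where
  "moebius_map a b c d (Fin z) = proj_quot (a * z + b) (c * z + d)"
| "moebius_map a b c d Infty = proj_quot a c"

definition is_moebius :: "(csphere \<Rightarrow> csphere) \<Rightarrow> bool" where
  "is_moebius M \<longleftrightarrow> (\<exists>a b c d. a * d - b * c \<noteq> 0 \<and> M = moebius_map a b c d)"

section \<open>The regular hexagonal lattice\<close>

definition \<omega> :: complex where "\<omega> = exp (2 * pi * \<i> / 3)"

definition \<epsilon> :: complex where "\<epsilon> = exp (pi * \<i> / 3)"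

definition hex_V :: "complex set" where
  "hex_V = {of_int k + of_int l * \<omega> + of_int m * \<omega>\<^sup>2 |k l m :: int. (k + l + m) mod 3 \<noteq> 0}"

definition hex_F :: "complex set" where
  "hex_F = {of_int k + of_int l * \<omega> + of_int m * \<omega>\<^sup>2 |k l m :: int. (k + l + m) mod 3 = 0}"

definition hex_E :: "complex set set" where
  "hex_E = {{a, b} |a b. a \<in> hex_V \<and> b \<in> hex_V \<and> dist a b = 1}"

text \<open>The classes \<open>E\<^sub>1, E\<^sub>2, E\<^sub>3\<close> are \<open>hex_Ecl j\<close> for \<open>j = 1, 2, 3\<close>.\<close>

definition hex_Ecl :: "nat \<Rightarrow> complex set set" where
  "hex_Ecl j = {{a, b} |a b. {a, b} \<in> hex_E \<and> (b - a = \<omega> ^ (j - 1) \<or> b - a = - (\<omega> ^ (j - 1)))}"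

text \<open>The vertices of the hexagon with center \<open>c\<close> in counterclockwise order; the integer
  index is read modulo 6, since \<open>\<epsilon>\<close> is a sixth root of unity.\<close>

definition hex_vertex :: "complex \<Rightarrow> int \<Rightarrow> complex" where
  "hex_vertex c i = c + \<epsilon> powi i"

definition hex_edge :: "complex \<Rightarrow> int \<Rightarrow> complex set" where
  "hex_edge c i = {hex_vertex c i, hex_vertex c (i + 1)}"

section \<open>Cross-ratios of a map on the vertices\<close>

text \<open>Maps on \<^term>\<open>hex_V\<close> and on \<^term>\<open>hex_E\<close> are total functions of which only the values
  on these sets are used.\<close>

definition edge_cross_ratio :: "(complex \<Rightarrow> csphere) \<Rightarrow> complex \<Rightarrow> int \<Rightarrow> csphere" where
  "edge_cross_ratio w c i =
     cross_ratio (w (hex_vertex c i)) (w (hex_vertex c (i + 1)))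
                 (w (hex_vertex c (i + 2))) (w (hex_vertex c (i - 1)))"

text \<open>Each edge is \<open>hex_edge c i\<close> for two centers \<open>c\<close>; this demands that both hexagons assign it
  the value \<open>T\<close>.\<close>

definition has_edge_cross_ratios :: "(complex \<Rightarrow> csphere) \<Rightarrow> (complex set \<Rightarrow> csphere) \<Rightarrow> bool" where
  "has_edge_cross_ratios w T \<longleftrightarrow>
     (\<forall>c\<in>hex_F. \<forall>i. edge_cross_ratio w c i = T (hex_edge c i))"

text \<open>Each vertex \<open>z\<close> has exactly one neighbor in each edge class, and \<open>z1, z2, z3\<close> are
  counterclockwise around \<open>z\<close>.\<close>

definition has_constant_S :: "(complex \<Rightarrow> csphere) \<Rightarrow> complex \<Rightarrow> bool" where
  "has_constant_S w S \<longleftrightarrow>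
     (\<forall>z\<in>hex_V. \<forall>z1 z2 z3.
        {z1, z} \<in> hex_Ecl 1 \<and> {z2, z} \<in> hex_Ecl 2 \<and> {z3, z} \<in> hex_Ecl 3 \<longrightarrow>
        cross_ratio (w z1) (w z2) (w z) (w z3) = Fin S)"

text \<open>\<open>x / y = r\<close>, where \<open>0 / 0\<close> is indeterminate and imposes no condition. The case \<open>0 / 0\<close>
  occurs in the relation below when two opposite vertices of a hexagon have the same image, which
  the constancy of \<open>S\<close> does not exclude.\<close>

definition ratio_is :: "complex \<Rightarrow> complex \<Rightarrow> complex \<Rightarrow> bool" where
  "ratio_is x y r \<longleftrightarrow> (y \<noteq> 0 \<and> x / y = r) \<or> (x = 0 \<and> y = 0)"

definition hex_relation ::
    "complex \<Rightarrow> complex \<Rightarrow> complex \<Rightarrow> complex \<Rightarrow> complex \<Rightarrow> complex \<Rightarrow> bool" where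
  "hex_relation t1 t2 t3 t4 t5 t6 \<longleftrightarrow>
     1 - t2 \<noteq> 0 \<and>
     (\<exists>r. ratio_is t1 t4 r \<and> ratio_is t3 t6 r \<and> ratio_is t5 t2 r \<and>
          r = (t1 + t3 - 1 - t1 * t2 * t3) / (1 - t2))"

text \<open>The cyclic numbering may start at any edge of the hexagon.\<close>

definition solves_hex :: "(complex set \<Rightarrow> csphere) \<Rightarrow> bool" where
  "solves_hex T \<longleftrightarrow>
     (\<forall>c\<in>hex_F. \<forall>i. \<exists>t1 t2 t3 t4 t5 t6.
        T (hex_edge c (i + 1)) = Fin t1 \<and> T (hex_edge c (i + 2)) = Fin t2 \<and>
        T (hex_edge c (i + 3)) = Fin t3 \<and> T (hex_edge c (i + 4)) = Fin t4 \<and>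
        T (hex_edge c (i + 5)) = Fin t5 \<and> T (hex_edge c (i + 6)) = Fin t6 \<and>
        hex_relation t1 t2 t3 t4 t5 t6)"

definition real_negative :: "(complex set \<Rightarrow> csphere) \<Rightarrow> bool" where
  "real_negative T \<longleftrightarrow> (\<forall>e\<in>hex_E. \<exists>t::real. t < 0 \<and> T e = Fin (of_real t))"

section \<open>Hexagonal circle patterns\<close>

text \<open>Circles on the sphere, straight lines with \<^term>\<open>Infty\<close> included, are the images
  of the unit circle under Moebius transformations \<open>M\<close>; the counterclockwise unit circle also
  orients the image. The images of the vertices of the hexagon lie on the
  circle given by \<open>M\<close>, in their circular order and oriented by it. Asking
  for increasing parameters is no restriction, because replacing \<open>M(z)\<close> by
  \<open>M(1 / z)\<close> reverses the orientation.\<close>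

definition hexagon_circle :: "(complex \<Rightarrow> csphere) \<Rightarrow> complex \<Rightarrow> (csphere \<Rightarrow> csphere) \<Rightarrow> bool" where
  "hexagon_circle w c M \<longleftrightarrow>
     is_moebius M \<and>
     (\<exists>\<theta> :: nat \<Rightarrow> real.
        (\<forall>k\<in>{1..5}. \<theta> k < \<theta> (k + 1)) \<and> \<theta> 6 < \<theta> 1 + 2 * pi \<and>
        (\<forall>k\<in>{1..6}. w (c + \<epsilon> ^ k) = M (Fin (cis (\<theta> k)))))"

definition circle_pattern :: "(complex \<Rightarrow> csphere) \<Rightarrow> bool" where
  "circle_pattern w \<longleftrightarrow> (\<forall>c\<in>hex_F. \<exists>M. hexagon_circle w c M)"

text \<open>Angles at \<^term>\<open>Infty\<close> are measured after applying the inversion \<open>z \<mapsto> 1 / z\<close>.\<close>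

definition chart_at :: "csphere \<Rightarrow> csphere \<Rightarrow> complex" where
  "chart_at p z = affine (if p = Infty then moebius_map 0 1 1 0 z else z)"

text \<open>The tangent vector at \<open>p\<close> of the oriented circle given by \<open>M\<close>.\<close>

definition circle_tangent :: "(csphere \<Rightarrow> csphere) \<Rightarrow> csphere \<Rightarrow> complex" where
  "circle_tangent M p =
     vector_derivative (\<lambda>t. chart_at p (M (Fin (cis t))))
       (at (SOME t. M (Fin (cis t)) = p))"

text \<open>The angle, in \<open>[0, \<pi>]\<close>, between the oriented circles given by \<open>M\<close> and \<open>M'\<close> at a
  common point \<open>p\<close>. Orienting the circles distinguishes the angle from its supplement.\<close>

definition intersection_angle ::
    "(csphere \<Rightarrow> csphere) \<Rightarrow> (csphere \<Rightarrow> csphere) \<Rightarrow> csphere \<Rightarrow> real" where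
  "intersection_angle M M' p = \<bar>Arg (circle_tangent M p / circle_tangent M' p)\<bar>"

text \<open>The angle at either endpoint \<open>z\<close> of an edge between the circles of its two adjacent
  hexagons depends only on the class of the edge.\<close>

definition constant_angles :: "(complex \<Rightarrow> csphere) \<Rightarrow> bool" where
  "constant_angles w \<longleftrightarrow>
     (\<exists>\<alpha> :: nat \<Rightarrow> real. \<forall>j\<in>{1, 2, 3}. \<forall>e\<in>hex_Ecl j. \<forall>c\<in>hex_F. \<forall>c'\<in>hex_F. \<forall>i i'.
        c \<noteq> c' \<and> hex_edge c i = e \<and> hex_edge c' i' = e \<longrightarrow>
        (\<forall>M M'. hexagon_circle w c M \<and> hexagon_circle w c' M' \<longrightarrow>
           (\<forall>z\<in>e. intersection_angle M M' (w z) = \<alpha> j)))"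

end

theory Submission
  imports Defs
begin

text \<open>The proof is about \<open>stars\<close>: the image of a vertex together with the images of its three
  neighbours. If \<open>S\<close> is the cross-ratio of a star and differs from \<open>0\<close> and \<open>1\<close>, the four
  points are distinct, and three of them determine the fourth.

  Let an edge from \<open>p\<close> to \<open>q\<close> carry the cross-ratio \<open>t\<close>. In each of the two hexagons beside it
  the cross-ratio \<open>t\<close> determines the next vertex after \<open>q\<close> from the vertex before \<open>p\<close>, so
  the star at \<open>p\<close> determines the star at \<open>q\<close>. The new star has again the value \<open>S\<close>, because
  the factor by which \<open>t\<close> enters is the same in the two hexagons (\<open>star_transfer\<close>).
  Conversely, if the stars at both ends have the value \<open>S\<close>, the two hexagons assign the
  same cross-ratio to the edge (\<open>edge_cross_ratios_agree\<close>). So a map with constant \<open>S\<close>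
  has a well defined \<open>T\<close>, and a pair of a map with constant \<open>S\<close> and its \<open>T\<close> is the same as a
  field of stars that is parallel for the transport along edges given by \<open>T\<close>.

  In any closed hexagon of points the quotients of opposite cross-ratios are all equal to minus the
  multi-ratio of the six points, and so is the last term of the hexagon relation
  (\<open>hexagon_relation\<close>). This proves the first part. Conversely, three consecutive
  cross-ratios determine the six points from three of them; the relation then says that the
  remaining three cross-ratios are the right ones (\<open>hexagon_closes\<close>). Hence the transport
  around every hexagon is the identity (\<open>edge_steps_close\<close>). Contracting all edges of one class
  turns the hexagonal lattice into the square lattice with the hexagons as unit squares, where
  such a flat transport has exactly one parallel field for each initial star
  (\<open>hexagonal_integration\<close>, \<open>hexagonal_section_unique\<close>). Any two stars with the same value \<open>S\<close>
  are related by a Moebius transformation, and this gives the uniqueness up to Moebius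
  transformations.

  If \<open>T\<close> is real-negative, a Moebius transformation takes three consecutive vertices of a hexagon to
  \<open>\<infinity>, 0, 1\<close>, and the signs of the cross-ratios force the other three to be real and
  increasing beyond \<open>1\<close> (\<open>six_points_in_order\<close>). Finally, an oriented circle through \<open>a, p, b\<close> has
  at \<open>p\<close> a tangent vector that is a positive multiple of \<open>(p - a) (b - p) / (b - a)\<close>. For the
  two circles that share the images of an edge, the quotient of these vectors is, up to
  sign and inversion, the cross-ratio of the star at \<open>p\<close>, so the intersection angle is a function
  of \<open>S\<close> and of the class of the edge (\<open>circle_angle\<close>).\<close>

section \<open>Moebius transformations and cross-ratios\<close>

text \<open>Homogeneous coordinates \<open>(num u : den u)\<close>, normalised so that \<open>sdiff\<close> is exactly their
  determinant. In them the case distinctions at infinity disappear.\<close>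

fun num :: "csphere \<Rightarrow> complex" where
  "num (Fin a) = a"
| "num Infty = 1"

fun den :: "csphere \<Rightarrow> complex" where
  "den (Fin a) = 1"
| "den Infty = 0"

lemma sdiff_num_den: "sdiff u v = num u * den v - num v * den u"
  by (cases u; cases v) auto

lemma num_den_nonzero: "num u \<noteq> 0 \<or> den u \<noteq> 0"
  by (cases u) auto

lemma proj_quot_num_den [simp]: "proj_quot (num u) (den u) = u"
  by (cases u) (auto simp: proj_quot_def)

lemma proj_quot_scale: "k \<noteq> 0 \<Longrightarrow> proj_quot (k * x) (k * y) = proj_quot x y"
  by (auto simp: proj_quot_def)

lemma num_den_proj_quot:
  assumes "x \<noteq> 0 \<or> y \<noteq> 0"
  obtains k where "k \<noteq> 0" "x = k * num (proj_quot x y)" "y = k * den (proj_quot x y)"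
proof (cases "y = 0")
  case True
  with assms show ?thesis by (intro that[of x]) (auto simp: proj_quot_def)
next
  case False
  with assms show ?thesis by (intro that[of y]) (auto simp: proj_quot_def)
qed

lemma moebius_map_num_den:
  "moebius_map a b c d u = proj_quot (a * num u + b * den u) (c * num u + d * den u)"
  by (cases u) auto

lemma sdiff_eq_0_iff [simp]: "sdiff u v = 0 \<longleftrightarrow> u = v"
  by (cases u; cases v) auto

lemma sdiff_self [simp]: "sdiff u u = 0"
  by simp

lemma sdiff_swap: "sdiff u v = - sdiff v u"
  by (cases u; cases v) auto

lemma sdiff_pluecker:
  "sdiff a b * sdiff c d - sdiff a c * sdiff b d + sdiff a d * sdiff b c = 0"
  unfolding sdiff_num_den by (simp add: algebra_simps)

lemma invertible_matrix_injective:
  fixes a b c d x y :: complex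
  assumes "a * d - b * c \<noteq> 0" "x \<noteq> 0 \<or> y \<noteq> 0"
  shows "a * x + b * y \<noteq> 0 \<or> c * x + d * y \<noteq> 0"
proof (rule ccontr)
  assume "\<not> ?thesis"
  then have 1: "a * x + b * y = 0" and 2: "c * x + d * y = 0" by auto
  have "(a * d - b * c) * x = d * (a * x + b * y) - b * (c * x + d * y)"
       "(a * d - b * c) * y = a * (c * x + d * y) - c * (a * x + b * y)"
    by (simp_all add: algebra_simps)
  with 1 2 assms show False by auto
qed

lemma moebius_map_num_den_scaled:
  assumes "a * d - b * c \<noteq> 0"
  obtains k where "k \<noteq> 0" "a * num u + b * den u = k * num (moebius_map a b c d u)"
    "c * num u + d * den u = k * den (moebius_map a b c d u)"
  using num_den_proj_quot[OF invertible_matrix_injective[OF assms num_den_nonzero]]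
  unfolding moebius_map_num_den by blast

lemma moebius_map_compose:
  assumes "a * d - b * c \<noteq> 0"
  shows "moebius_map a' b' c' d' (moebius_map a b c d u) =
    moebius_map (a' * a + b' * c) (a' * b + b' * d) (c' * a + d' * c) (c' * b + d' * d) u"
proof -
  obtain k where k: "k \<noteq> 0" "a * num u + b * den u = k * num (moebius_map a b c d u)"
    "c * num u + d * den u = k * den (moebius_map a b c d u)"
    using moebius_map_num_den_scaled[OF assms] .
  let ?v = "moebius_map a b c d u"
  have "moebius_map a' b' c' d' ?v =
      proj_quot (k * (a' * num ?v + b' * den ?v)) (k * (c' * num ?v + d' * den ?v))"
    unfolding moebius_map_num_den[of a' b' c' d'] by (simp add: proj_quot_scale k)
  also have "k * (a' * num ?v + b' * den ?v) = a' * (k * num ?v) + b' * (k * den ?v)"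
    by (simp add: algebra_simps)
  also have "k * (c' * num ?v + d' * den ?v) = c' * (k * num ?v) + d' * (k * den ?v)"
    by (simp add: algebra_simps)
  finally show ?thesis
    unfolding k(2,3)[symmetric] moebius_map_num_den[of "a' * a + b' * c"]
    by (simp add: algebra_simps)
qed

lemma is_moebius_id: "is_moebius (\<lambda>u. u)"
proof -
  have "(\<lambda>u. u) = moebius_map 1 0 0 1"
    by (rule ext) (simp add: moebius_map_num_den)
  then show ?thesis unfolding is_moebius_def
    by (intro exI[of _ 1] exI[of _ 0] conjI) simp_all
qed

lemma is_moebius_compose:
  assumes "is_moebius M" "is_moebius N"
  shows "is_moebius (\<lambda>u. M (N u))"
proof -
  obtain a b c d a' b' c' d' where d: "a * d - b * c \<noteq> 0" "N = moebius_map a b c d"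
      "a' * d' - b' * c' \<noteq> 0" "M = moebius_map a' b' c' d'"
    using assms unfolding is_moebius_def by metis
  have "(a' * a + b' * c) * (c' * b + d' * d) - (a' * b + b' * d) * (c' * a + d' * c) =
      (a' * d' - b' * c') * (a * d - b * c)" by (simp add: algebra_simps)
  then have "(a' * a + b' * c) * (c' * b + d' * d) - (a' * b + b' * d) * (c' * a + d' * c) \<noteq> 0"
    using d by simp
  moreover have "(\<lambda>u. M (N u)) =
      moebius_map (a' * a + b' * c) (a' * b + b' * d) (c' * a + d' * c) (c' * b + d' * d)"
    using d moebius_map_compose by auto
  ultimately show ?thesis unfolding is_moebius_def by blast
qed

lemma is_moebius_inverse:
  assumes "is_moebius M"
  obtains N where "is_moebius N" "\<And>u. N (M u) = u" "\<And>u. M (N u) = u"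
proof -
  obtain a b c d where d: "a * d - b * c \<noteq> 0" "M = moebius_map a b c d"
    using assms unfolding is_moebius_def by metis
  let ?N = "moebius_map d (- b) (- c) a"
  have d': "d * a - (- b) * (- c) \<noteq> 0" using d by (simp add: algebra_simps)
  have scalar: "moebius_map e 0 0 e u = u" if "e \<noteq> 0" for e u
    using that by (simp add: moebius_map_num_den proj_quot_scale)
  have "?N (M u) = u" for u
    using scalar[OF d(1), of u]
    unfolding d(2) moebius_map_compose[OF d(1)] by (simp add: algebra_simps)
  moreover have "M (?N u) = u" for u
    using scalar[OF d(1), of u]
    unfolding d(2) moebius_map_compose[OF d'] by (simp add: algebra_simps)
  moreover have "is_moebius ?N"
    using d' unfolding is_moebius_def by blast
  ultimately show ?thesis using that by blast
qed

lemma is_moebius_inj: "is_moebius M \<Longrightarrow> M u = M v \<longleftrightarrow> u = v"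
  using is_moebius_inverse by metis

text \<open>A matrix multiplies determinants of coordinate vectors by its own determinant. The factors \<open>k\<close>
  come from normalising the images; they cancel in every expression that is homogeneous of degree
  zero in each of its points, such as the cross-ratio.\<close>

lemma moebius_map_sdiff:
  assumes d: "a * d - b * c \<noteq> 0"
  obtains k where "\<And>u. k u \<noteq> 0" "\<And>u. a * num u + b * den u = k u * num (moebius_map a b c d u)"
    "\<And>u. c * num u + d * den u = k u * den (moebius_map a b c d u)"
    "\<And>u v. (a * d - b * c) * sdiff u v =
      k u * k v * sdiff (moebius_map a b c d u) (moebius_map a b c d v)"
proof -
  let ?M = "moebius_map a b c d"
  have "\<forall>u. \<exists>k. k \<noteq> 0 \<and> a * num u + b * den u = k * num (?M u) \<and>
      c * num u + d * den u = k * den (?M u)"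
    using moebius_map_num_den_scaled[OF d] by metis
  then obtain k where k: "\<And>u. k u \<noteq> 0" "\<And>u. a * num u + b * den u = k u * num (?M u)"
      "\<And>u. c * num u + d * den u = k u * den (?M u)"
    by metis
  have "(a * d - b * c) * sdiff u v = k u * k v * sdiff (?M u) (?M v)" for u v
  proof -
    have "k u * k v * sdiff (?M u) (?M v) =
        (k u * num (?M u)) * (k v * den (?M v)) - (k v * num (?M v)) * (k u * den (?M u))"
      unfolding sdiff_num_den by (simp add: algebra_simps)
    then show ?thesis
      unfolding k(2,3)[symmetric] sdiff_num_den by (simp add: algebra_simps)
  qed
  with k that show ?thesis by blast
qed

lemma cross_ratio_moebius:
  assumes "is_moebius M"
  shows "cross_ratio (M z1) (M z2) (M z3) (M z4) = cross_ratio z1 z2 z3 z4"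
proof -
  obtain a b c d where d: "a * d - b * c \<noteq> 0" "M = moebius_map a b c d"
    using assms unfolding is_moebius_def by metis
  obtain k where k: "\<And>u. k u \<noteq> 0"
    and sd: "\<And>u v. (a * d - b * c) * sdiff u v = k u * k v * sdiff (M u) (M v)"
    using moebius_map_sdiff[OF d(1)] unfolding d(2) by metis
  let ?D = "a * d - b * c"
  let ?K = "k z1 * k z2 * k z3 * k z4"
  have "proj_quot (sdiff z2 z1 * sdiff z4 z3) (sdiff z3 z2 * sdiff z1 z4)
      = proj_quot (?D\<^sup>2 * (sdiff z2 z1 * sdiff z4 z3)) (?D\<^sup>2 * (sdiff z3 z2 * sdiff z1 z4))"
    using d by (simp add: proj_quot_scale)
  also have "?D\<^sup>2 * (sdiff z2 z1 * sdiff z4 z3) = (?D * sdiff z2 z1) * (?D * sdiff z4 z3)"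
    by (simp add: power2_eq_square)
  also have "\<dots> = ?K * (sdiff (M z2) (M z1) * sdiff (M z4) (M z3))"
    unfolding sd by (simp add: algebra_simps)
  also have "?D\<^sup>2 * (sdiff z3 z2 * sdiff z1 z4) = (?D * sdiff z3 z2) * (?D * sdiff z1 z4)"
    by (simp add: power2_eq_square)
  also have "\<dots> = ?K * (sdiff (M z3) (M z2) * sdiff (M z1) (M z4))"
    unfolding sd by (simp add: algebra_simps)
  finally show ?thesis
    unfolding cross_ratio_def using k by (simp add: proj_quot_scale)
qed

text \<open>Numerator and denominator of the cross-ratio are linear in the homogeneous coordinates of the
  third point. Thus the cross-ratio is a coordinate on the sphere that takes \<open>p, q, a\<close>
  to \<open>1, \<infinity>, 0\<close>. It makes the fourth point unique, and comparing two such
  coordinates gives the Moebius transformation between two triples.\<close>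

lemma is_moebius_cross_ratio:
  assumes "p \<noteq> q" "p \<noteq> a" "q \<noteq> a"
  shows "is_moebius (\<lambda>x. cross_ratio p q x a)"
proof -
  let ?A = "- (sdiff q p * den a)" and ?B = "sdiff q p * num a"
  let ?C = "sdiff p a * den q" and ?D = "- (sdiff p a * num q)"
  have "?A * ?D - ?B * ?C = sdiff q p * sdiff p a * sdiff q a"
    unfolding sdiff_num_den by (simp add: algebra_simps)
  then have "?A * ?D - ?B * ?C \<noteq> 0" using assms by simp
  moreover have "(\<lambda>x. cross_ratio p q x a) = moebius_map ?A ?B ?C ?D"
    unfolding cross_ratio_def moebius_map_num_den sdiff_num_den
    by (simp add: algebra_simps)
  ultimately show ?thesis unfolding is_moebius_def by blast
qed

lemma cross_ratio_bij:
  assumes "p \<noteq> q" "p \<noteq> a" "q \<noteq> a"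
  shows "\<exists>!x. cross_ratio p q x a = t"
  using is_moebius_cross_ratio[OF assms] is_moebius_inverse by metis

lemma cross_ratio_frame:
  assumes "p \<noteq> q" "p \<noteq> a" "q \<noteq> a"
  shows "cross_ratio p q p a = Fin 1" "cross_ratio p q q a = Infty" "cross_ratio p q a a = Fin 0"
  using assms sdiff_swap[of q p] sdiff_swap[of a p]
  by (auto simp: cross_ratio_def proj_quot_def)

lemma moebius_three_points:
  assumes "p \<noteq> q" "p \<noteq> a" "q \<noteq> a" "p' \<noteq> q'" "p' \<noteq> a'" "q' \<noteq> a'"
  obtains M where "is_moebius M" "M p = p'" "M q = q'" "M a = a'"
proof -
  obtain N where N: "is_moebius N" "\<And>u. N (cross_ratio p' q' u a') = u"
    using is_moebius_inverse[OF is_moebius_cross_ratio[OF assms(4-6)]] by metis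
  show ?thesis
  proof
    show "is_moebius (\<lambda>u. N (cross_ratio p q u a))"
      using is_moebius_compose[OF N(1) is_moebius_cross_ratio[OF assms(1-3)]] .
  qed (use N(2)[of p'] N(2)[of q'] N(2)[of a'] cross_ratio_frame[OF assms(1-3)]
      cross_ratio_frame[OF assms(4-6)] in auto)
qed

text \<open>By this, identities between cross-ratios of finitely many points need to be checked only for
  complex numbers.\<close>

lemma moebius_avoid_infty:
  assumes "finite X"
  obtains M where "is_moebius M" "\<And>u. u \<in> X \<Longrightarrow> M u \<noteq> Infty"
proof -
  have "inj Fin" by (auto simp: inj_def)
  then have "finite (Fin -` X)" using assms by (rule finite_vimageI[rotated])
  then obtain \<zeta> where z: "Fin \<zeta> \<notin> X"
    using ex_new_if_finite[OF infinite_UNIV_char_0] by blast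
  \<comment> \<open>The transformation \<open>z \<mapsto> 1 / (z - \<zeta>)\<close> takes only \<open>\<zeta>\<close> to infinity.\<close>
  show ?thesis
  proof
    show "is_moebius (moebius_map 0 1 1 (- \<zeta>))"
      unfolding is_moebius_def
      by (rule exI[of _ 0], rule exI[of _ 1], rule exI[of _ 1], rule exI[of _ "- \<zeta>"]) simp
    show "moebius_map 0 1 1 (- \<zeta>) u \<noteq> Infty" if "u \<in> X" for u
      using that z by (cases u) (auto simp: proj_quot_def)
  qed
qed

lemma cross_ratio_eq_Fin_iff:
  "cross_ratio z1 z2 z3 z4 = Fin t \<longleftrightarrow>
     z3 \<noteq> z2 \<and> z1 \<noteq> z4 \<and> sdiff z2 z1 * sdiff z4 z3 = t * (sdiff z3 z2 * sdiff z1 z4)"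
  by (auto simp: cross_ratio_def proj_quot_def field_simps)

text \<open>The Pluecker relation turns \<open>1 - t\<close> into a cross-ratio of the same points, with the diagonals
  \<open>z1 z3\<close> and \<open>z2 z4\<close> in its numerator. So \<open>t \<noteq> 1\<close> keeps these pairs apart.\<close>

lemma cross_ratio_complement:
  assumes "cross_ratio z1 z2 z3 z4 = Fin t"
  shows "sdiff z3 z1 * sdiff z2 z4 = (1 - t) * (sdiff z3 z2 * sdiff z1 z4)"
proof -
  have "sdiff z2 z1 * sdiff z4 z3 = t * (sdiff z3 z2 * sdiff z1 z4)"
    using assms by (simp add: cross_ratio_eq_Fin_iff)
  then show ?thesis
    using sdiff_pluecker[of z3 z2 z1 z4] sdiff_swap[of z4 z3] sdiff_swap[of z2 z1]
    by (simp add: algebra_simps)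
qed

lemma cross_ratio_reverse: "cross_ratio z2 z1 z4 z3 = cross_ratio z1 z2 z3 z4"
  using sdiff_swap[of z1 z2] sdiff_swap[of z3 z4] sdiff_swap[of z4 z1] sdiff_swap[of z2 z3]
  by (simp add: cross_ratio_def mult.commute)

lemma cross_ratio_distinct:
  assumes "cross_ratio z1 z2 z3 z4 = Fin t" "t \<noteq> 1" "z1 \<noteq> z2" "z1 \<noteq> z4"
  shows "z3 \<noteq> z1" "z2 \<noteq> z4" "z3 \<noteq> z2"
proof -
  have "z3 \<noteq> z2" using assms by (simp add: cross_ratio_eq_Fin_iff)
  moreover have "sdiff z3 z1 * sdiff z2 z4 \<noteq> 0"
    using cross_ratio_complement[OF assms(1)] assms calculation by simp
  ultimately show "z3 \<noteq> z1" "z2 \<noteq> z4" "z3 \<noteq> z2" by auto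
qed

section \<open>Cross-ratios at a vertex and along an edge\<close>

text \<open>A rotation of the three neighbours of a vertex acts on the cross-ratio of the star by the
  substitution \<open>S \<mapsto> 1 - 1 / S \<mapsto> 1 / (1 - S) \<mapsto> S\<close> of order three, which
  preserves \<open>{0, 1, \<infinity>}\<close>. It reduces statements about the three edge classes to one.\<close>

lemma cross_ratio_rotate_iff:
  assumes "S \<noteq> 0" "S \<noteq> 1"
  shows "cross_ratio a2 a3 p a1 = Fin (1 - 1 / S) \<longleftrightarrow> cross_ratio a1 a2 p a3 = Fin S"
    and "cross_ratio a3 a1 p a2 = Fin (1 / (1 - S)) \<longleftrightarrow> cross_ratio a1 a2 p a3 = Fin S"
proof -
  have rotate: "cross_ratio b2 b3 q b1 = Fin (1 - 1 / R)"
    if R: "R \<noteq> 0" "R \<noteq> 1" and cr: "cross_ratio b1 b2 q b3 = Fin R" for b1 b2 b3 q R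
  proof -
    have eq: "sdiff b2 b1 * sdiff b3 q = R * (sdiff q b2 * sdiff b1 b3)"
      and ne: "q \<noteq> b2" "b1 \<noteq> b3" using cr by (auto simp: cross_ratio_eq_Fin_iff)
    have "sdiff q b1 * sdiff b2 b3 = (1 - R) * (sdiff q b2 * sdiff b1 b3)"
      by (rule cross_ratio_complement[OF cr])
    then have "sdiff b3 b2 * sdiff b1 q = (1 - R) * (sdiff q b2 * sdiff b1 b3)"
      using sdiff_swap[of b3 b2] sdiff_swap[of b1 q] by (simp add: mult.commute)
    also have "\<dots> = - ((1 - R) / R) * (sdiff b2 b1 * sdiff q b3)"
    proof -
      have "sdiff b2 b1 * sdiff q b3 = - (R * (sdiff q b2 * sdiff b1 b3))"
        using eq sdiff_swap[of b3 q] by (metis minus_mult_right add.inverse_inverse)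
      then show ?thesis using R by simp
    qed
    also have "- ((1 - R) / R) = 1 - 1 / R" using R by (simp add: field_simps)
    finally have "sdiff b3 b2 * sdiff b1 q = (1 - 1 / R) * (sdiff q b3 * sdiff b2 b1)"
      by (simp add: mult.commute)
    moreover have "sdiff b2 b1 * sdiff b3 q \<noteq> 0" using eq ne R by simp
    ultimately show ?thesis by (auto simp: cross_ratio_eq_Fin_iff)
  qed
  have S': "1 - 1 / S \<noteq> 0" "1 - 1 / S \<noteq> 1" "1 - 1 / (1 - 1 / S) = 1 / (1 - S)"
    using assms by (simp_all add: field_simps)
  have S'': "1 / (1 - S) \<noteq> 0" "1 / (1 - S) \<noteq> 1" "1 - 1 / (1 / (1 - S)) = S"
    using assms by (simp_all add: field_simps)
  note r = rotate[OF assms] rotate[OF S'(1,2), unfolded S'(3)]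
    rotate[OF S''(1,2), unfolded S''(3)]
  show "cross_ratio a2 a3 p a1 = Fin (1 - 1 / S) \<longleftrightarrow> cross_ratio a1 a2 p a3 = Fin S"
    and "cross_ratio a3 a1 p a2 = Fin (1 / (1 - S)) \<longleftrightarrow> cross_ratio a1 a2 p a3 = Fin S"
    using r by blast+
qed

lemma cross_ratio_all_distinct:
  assumes "cross_ratio z1 z2 z3 z4 = Fin t" "t \<noteq> 0" "t \<noteq> 1"
  shows "z1 \<noteq> z2" "z1 \<noteq> z3" "z1 \<noteq> z4" "z2 \<noteq> z3" "z2 \<noteq> z4" "z3 \<noteq> z4"
proof -
  have *: "z3 \<noteq> z2" "z1 \<noteq> z4" "sdiff z2 z1 * sdiff z4 z3 = t * (sdiff z3 z2 * sdiff z1 z4)"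
    using assms by (auto simp: cross_ratio_eq_Fin_iff)
  then have "sdiff z2 z1 * sdiff z4 z3 \<noteq> 0" using assms by simp
  moreover have "sdiff z3 z1 * sdiff z2 z4 \<noteq> 0"
    using cross_ratio_complement[OF assms(1)] * assms by simp
  ultimately show "z1 \<noteq> z2" "z1 \<noteq> z3" "z1 \<noteq> z4" "z2 \<noteq> z3" "z2 \<noteq> z4" "z3 \<noteq> z4"
    using * by auto
qed

lemma cross_ratio_swap_pairs: "cross_ratio z3 z4 z1 z2 = cross_ratio z1 z2 z3 z4"
  by (simp add: cross_ratio_def mult.commute)

definition fourth :: "csphere \<Rightarrow> csphere \<Rightarrow> csphere \<Rightarrow> csphere \<Rightarrow> csphere" where
  "fourth p q a t = (THE x. cross_ratio p q x a = t)"

lemma fourth_eq_iff: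
  assumes "p \<noteq> q" "p \<noteq> a" "q \<noteq> a"
  shows "fourth p q a t = x \<longleftrightarrow> cross_ratio p q x a = t"
  using theI'[OF cross_ratio_bij[OF assms, of t]] cross_ratio_bij[OF assms, of t]
  unfolding fourth_def by blast

text \<open>Here \<open>p\<close> and \<open>q\<close> are the ends of an edge, \<open>a, b\<close> the other neighbours of \<open>p\<close> and \<open>a', b'\<close>
  those of \<open>q\<close>, with \<open>a\<close> and \<open>a'\<close> in one hexagon. By \<open>cross_ratio_complement\<close> both pairs satisfy
  \<open>(a' - p) / (a' - q) = (1 - t) (p - a) / (q - a)\<close>. Dividing these equations for \<open>a\<close> and \<open>b\<close>
  by each other removes \<open>1 - t\<close> and leaves the cross-ratios of the two stars.\<close>

lemma star_transfer:
  assumes s: "cross_ratio q a p b = Fin s" "s \<noteq> 0" "s \<noteq> 1"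
    and ta: "cross_ratio p q a' a = Fin t" and tb: "cross_ratio p q b' b = Fin t" and t: "t \<noteq> 1"
  shows "cross_ratio p b' q a' = Fin s"
proof -
  note d = cross_ratio_all_distinct[OF s]
  have da: "a' \<noteq> p" "a' \<noteq> q" using cross_ratio_distinct[OF ta t] d by auto
  have db: "b' \<noteq> p" "b' \<noteq> q" using cross_ratio_distinct[OF tb t] d by auto
  have A: "sdiff a' p * sdiff q a = (1 - t) * (sdiff a' q * sdiff p a)"
    by (rule cross_ratio_complement[OF ta])
  have B: "sdiff b' p * sdiff q b = (1 - t) * (sdiff b' q * sdiff p b)"
    by (rule cross_ratio_complement[OF tb])
  have E: "sdiff a q * sdiff b p = s * (sdiff p a * sdiff q b)"
    using s by (simp add: cross_ratio_eq_Fin_iff)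
  have nz: "sdiff q a \<noteq> 0" "sdiff q b \<noteq> 0" "sdiff p a \<noteq> 0" "1 - t \<noteq> 0" using d t by auto
  have E': "sdiff q a * sdiff p b = s * (sdiff p a * sdiff q b)"
    using E sdiff_swap[of a q] sdiff_swap[of b p] by simp
  have "(sdiff b' p * sdiff a' q) * (sdiff p a * sdiff q b)
      = (sdiff b' p * sdiff q b) * (sdiff a' q * sdiff p a)"
    by simp
  also have "\<dots> = sdiff b' q * sdiff p b * ((1 - t) * (sdiff a' q * sdiff p a))"
    unfolding B by simp
  also have "\<dots> = sdiff b' q * sdiff a' p * (sdiff q a * sdiff p b)"
    unfolding A[symmetric] by simp
  also have "\<dots> = s * (sdiff b' q * sdiff a' p) * (sdiff p a * sdiff q b)"
    unfolding E' by simp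
  finally have "(sdiff b' p * sdiff a' q) = s * (sdiff b' q * sdiff a' p)"
    using nz by simp
  then have "sdiff b' p * sdiff a' q = s * (sdiff q b' * sdiff p a')"
    using sdiff_swap[of b' q] sdiff_swap[of a' p] by simp
  then show ?thesis using da db by (auto simp: cross_ratio_eq_Fin_iff)
qed

text \<open>The converse of \<open>star_transfer\<close>: the point \<open>b''\<close> that has the right cross-ratio in the second
  hexagon completes the star at \<open>q\<close> correctly, and so does \<open>b'\<close>; hence they coincide.\<close>

lemma edge_cross_ratios_agree:
  assumes s: "cross_ratio q a p b = Fin s" "s \<noteq> 0" "s \<noteq> 1"
    and s': "cross_ratio p b' q a' = Fin s"
  shows "cross_ratio p q a' a = cross_ratio p q b' b"
proof -
  note d = cross_ratio_all_distinct[OF s] and d' = cross_ratio_all_distinct[OF s' s(2,3)]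
  define t where "t = sdiff q p * sdiff a a' / (sdiff a' q * sdiff p a)"
  have ta: "cross_ratio p q a' a = Fin t"
    using d d' by (auto simp: cross_ratio_eq_Fin_iff t_def field_simps)
  have "sdiff a' p * sdiff q a \<noteq> 0" using d d' by auto
  then have t: "t \<noteq> 1" using cross_ratio_complement[OF ta] by auto
  obtain b'' where tb: "cross_ratio p q b'' b = Fin t"
    using cross_ratio_bij[of p q b] d by metis
  have "cross_ratio p b'' q a' = Fin s" by (rule star_transfer[OF s ta tb t])
  then have "cross_ratio a' q b'' p = cross_ratio a' q b' p"
    using s' by (metis cross_ratio_reverse cross_ratio_swap_pairs)
  then have "b'' = b'" using cross_ratio_bij[of a' q p] d' by metis
  then show ?thesis using ta tb by simp
qed

section \<open>Cross-ratios in a hexagon\<close>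

text \<open>The parameters \<open>a, \<dots>, e\<close> are the successive differences of six complex numbers
  \<open>y0, \<dots>, y5\<close>, and \<open>t1, t2, t3\<close> are the cross-ratios of the edges \<open>y1 y2\<close>, \<open>y2 y3\<close>, \<open>y3 y4\<close>.
  The factor of \<open>1 - t2\<close> is minus the multi-ratio
  \<open>(y2 - y1) (y4 - y3) (y0 - y5) / ((y1 - y0) (y3 - y2) (y5 - y4))\<close>.\<close>

lemma multi_ratio_identity:
  fixes a b c d e :: complex
  assumes nz: "a \<noteq> 0" "b \<noteq> 0" "c \<noteq> 0" "d \<noteq> 0" "e \<noteq> 0"
    and t: "t1 = - b * (a + b + c) / (c * a)" "t2 = - c * (b + c + d) / (d * b)"
      "t3 = - d * (c + d + e) / (e * c)"
  shows "t1 + t3 - 1 - t1 * t2 * t3 = b * d * (a + b + c + d + e) / (a * c * e) * (1 - t2)"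
proof -
  have p: "t1 * t2 = (a + b + c) * (b + c + d) / (a * d)"
    unfolding t using nz by (simp add: field_simps)
  show ?thesis
    unfolding p unfolding t using nz by (simp add: field_simps)
qed

lemma cross_ratio_Fin_iff:
  "cross_ratio (Fin a) (Fin b) (Fin c) (Fin d) = Fin t \<longleftrightarrow>
     c \<noteq> b \<and> a \<noteq> d \<and> (b - a) * (d - c) = t * ((c - b) * (a - d))"
  by (simp add: cross_ratio_eq_Fin_iff)

lemma ratio_is_iff: "r \<noteq> 0 \<Longrightarrow> ratio_is x y r \<longleftrightarrow> x = r * y"
  by (auto simp: ratio_is_def)

lemma ratio_isD: "ratio_is x y r \<Longrightarrow> x = r * y"
  by (auto simp: ratio_is_def)

lemma moebius_to_finite:
  obtains M y0 y1 y2 y3 y4 y5 where "is_moebius M" "M x0 = Fin y0" "M x1 = Fin y1"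
    "M x2 = Fin y2" "M x3 = Fin y3" "M x4 = Fin y4" "M x5 = Fin y5"
proof -
  obtain M where M: "is_moebius M" "\<And>u. u \<in> {x0, x1, x2, x3, x4, x5} \<Longrightarrow> M u \<noteq> Infty"
    using moebius_avoid_infty[of "{x0, x1, x2, x3, x4, x5}"] by auto
  have "\<exists>y. M u = Fin y" if "u \<in> {x0, x1, x2, x3, x4, x5}" for u
    using M(2)[OF that] by (cases "M u") auto
  then show ?thesis using M(1) that by (metis insertCI)
qed

text \<open>Each of the quotients \<open>t1 / t4\<close>, \<open>t3 / t0\<close>, \<open>t5 / t2\<close> is minus the same multi-ratio of the six
  points, because the diagonals in the two cross-ratios cancel.\<close>

lemma hexagon_relation:
  assumes t0: "cross_ratio x0 x1 x2 x5 = Fin t0" and t1: "cross_ratio x1 x2 x3 x0 = Fin t1"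
    and t2: "cross_ratio x2 x3 x4 x1 = Fin t2" and t3: "cross_ratio x3 x4 x5 x2 = Fin t3"
    and t4: "cross_ratio x4 x5 x0 x3 = Fin t4" and t5: "cross_ratio x5 x0 x1 x4 = Fin t5"
    and ne: "x4 \<noteq> x2" "x3 \<noteq> x1"
  shows "hex_relation t1 t2 t3 t4 t5 t0"
proof -
  obtain M y0 y1 y2 y3 y4 y5 where M: "is_moebius M" and y: "M x0 = Fin y0" "M x1 = Fin y1"
    "M x2 = Fin y2" "M x3 = Fin y3" "M x4 = Fin y4" "M x5 = Fin y5"
    by (rule moebius_to_finite)
  note inv = trans[OF cross_ratio_moebius[OF M]]
  note tM = inv[OF t0, unfolded y cross_ratio_Fin_iff]
    inv[OF t1, unfolded y cross_ratio_Fin_iff] inv[OF t2, unfolded y cross_ratio_Fin_iff]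
    inv[OF t3, unfolded y cross_ratio_Fin_iff] inv[OF t4, unfolded y cross_ratio_Fin_iff]
    inv[OF t5, unfolded y cross_ratio_Fin_iff]
  have "1 - t2 \<noteq> 0"
  proof
    assume "1 - t2 = 0"
    then have "sdiff x4 x2 * sdiff x3 x1 = 0" using cross_ratio_complement[OF t2] by simp
    with ne show False by simp
  qed
  define a b c d e where abc: "a = y1 - y0" "b = y2 - y1" "c = y3 - y2" "d = y4 - y3" "e = y5 - y4"
  define f where "f = a + b + c + d + e"
  have f: "f = y5 - y0" unfolding f_def abc by simp
  define g h k where ghk: "g = a + b + c" "h = b + c + d" "k = c + d + e"
  have eqs: "y1 - y0 = a" "y2 - y1 = b" "y3 - y2 = c" "y4 - y3 = d" "y5 - y4 = e" "y0 - y5 = - f"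
    "y5 - y2 = k" "y0 - y3 = - g" "y1 - y4 = - h" "y2 - y5 = - k" "y3 - y0 = g" "y4 - y1 = h"
    unfolding f abc ghk by simp_all
  have nz: "a \<noteq> 0" "b \<noteq> 0" "c \<noteq> 0" "d \<noteq> 0" "e \<noteq> 0" "f \<noteq> 0"
    using tM unfolding abc f by auto
  have t: "t0 = - a * k / (b * f)" "t1 = - b * g / (c * a)"
     "t2 = - c * h / (d * b)" "t3 = - d * k / (e * c)"
     "t4 = - e * g / (f * d)" "t5 = - f * h / (a * e)"
    using tM[unfolded eqs] nz by (simp_all add: eq_divide_eq ac_simps)
  define r where "r = b * d * f / (a * c * e)"
  have r0: "r \<noteq> 0" unfolding r_def using nz by simp
  have "ratio_is t1 t4 r" "ratio_is t3 t0 r" "ratio_is t5 t2 r"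
    unfolding ratio_is_iff[OF r0] unfolding t r_def using nz by (simp_all add: field_simps)
  moreover have "r * (1 - t2) = t1 + t3 - 1 - t1 * t2 * t3"
    unfolding r_def f_def using multi_ratio_identity[OF nz(1-5) t(2-4)[unfolded ghk]] by simp
  ultimately show ?thesis
    unfolding hex_relation_def using \<open>1 - t2 \<noteq> 0\<close> by (auto simp: field_simps)
qed

text \<open>The cross-ratios \<open>t1, t2, t3\<close> involve all six points but not the edge \<open>x5 x0\<close>. The relation
  identifies \<open>r\<close> with minus the multi-ratio; as \<open>r\<close> is not zero, this edge does not
  degenerate, and \<open>t4, t0, t5\<close> are obtained from the opposite cross-ratios by \<open>r\<close>.\<close>

lemma hexagon_closes:
  assumes rel: "hex_relation t1 t2 t3 t4 t5 t0"
    and t1: "cross_ratio x1 x2 x3 x0 = Fin t1"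
    and t2: "cross_ratio x2 x3 x4 x1 = Fin t2" and t3: "cross_ratio x3 x4 x5 x2 = Fin t3"
    and ne: "x0 \<noteq> x1" "x4 \<noteq> x5"
  shows "cross_ratio x4 x5 x0 x3 = Fin t4" "cross_ratio x5 x0 x1 x4 = Fin t5"
    "cross_ratio x0 x1 x2 x5 = Fin t0"
proof -
  obtain M y0 y1 y2 y3 y4 y5 where M: "is_moebius M" and y: "M x0 = Fin y0" "M x1 = Fin y1"
    "M x2 = Fin y2" "M x3 = Fin y3" "M x4 = Fin y4" "M x5 = Fin y5"
    by (rule moebius_to_finite)
  note inv = trans[OF cross_ratio_moebius[OF M]]
  note tM = inv[OF t1, unfolded y cross_ratio_Fin_iff] inv[OF t2, unfolded y cross_ratio_Fin_iff]
    inv[OF t3, unfolded y cross_ratio_Fin_iff]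
  obtain r where "1 - t2 \<noteq> 0" "ratio_is t1 t4 r" "ratio_is t3 t0 r" "ratio_is t5 t2 r"
    and r: "r = (t1 + t3 - 1 - t1 * t2 * t3) / (1 - t2)"
    using rel unfolding hex_relation_def by blast
  then have rt: "t1 = r * t4" "t3 = r * t0" "t5 = r * t2" using ratio_isD by blast+
  have "r \<noteq> 0"
  proof
    assume "r = 0"
    \<comment> \<open>The formula for \<open>r\<close> then gives \<open>- 1 / (1 - t2)\<close>.\<close>
    with rt have "t1 = 0" "t3 = 0" by auto
    with r \<open>r = 0\<close> \<open>1 - t2 \<noteq> 0\<close> show False by simp
  qed
  define a b c d e where abc: "a = y1 - y0" "b = y2 - y1" "c = y3 - y2" "d = y4 - y3" "e = y5 - y4"
  define f where "f = a + b + c + d + e"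
  have f: "f = y5 - y0" unfolding f_def abc by simp
  define g h k where ghk: "g = a + b + c" "h = b + c + d" "k = c + d + e"
  have eqs: "y1 - y0 = a" "y2 - y1 = b" "y3 - y2 = c" "y4 - y3 = d" "y5 - y4 = e" "y0 - y5 = - f"
    "y5 - y2 = k" "y0 - y3 = - g" "y1 - y4 = - h" "y2 - y5 = - k" "y3 - y0 = g" "y4 - y1 = h"
    unfolding f abc ghk by simp_all
  have "M x0 \<noteq> M x1" "M x4 \<noteq> M x5" using ne is_moebius_inj[OF M] by auto
  then have nz: "a \<noteq> 0" "b \<noteq> 0" "c \<noteq> 0" "d \<noteq> 0" "e \<noteq> 0"
    using tM unfolding abc y by auto
  have t: "t1 = - b * g / (c * a)"
     "t2 = - c * h / (d * b)" "t3 = - d * k / (e * c)"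
    using tM[unfolded eqs] nz by (simp_all add: eq_divide_eq ac_simps)
  have "r * (1 - t2) = t1 + t3 - 1 - t1 * t2 * t3"
    using r \<open>1 - t2 \<noteq> 0\<close> by simp
  also have "\<dots> = b * d * f / (a * c * e) * (1 - t2)"
    unfolding f_def by (rule multi_ratio_identity[OF nz t[unfolded ghk]])
  finally have rf: "r = b * d * f / (a * c * e)" using \<open>1 - t2 \<noteq> 0\<close>
    by (metis mult_right_cancel)
  with \<open>r \<noteq> 0\<close> have "f \<noteq> 0" by auto
  have "t4 = t1 / r" "t0 = t3 / r" using rt \<open>r \<noteq> 0\<close> by auto
  then have t': "t0 = - a * k / (b * f)" "t4 = - e * g / (f * d)"
     "t5 = - f * h / (a * e)"
    using nz \<open>f \<noteq> 0\<close> unfolding rt(3) unfolding rf t by (simp_all add: field_simps)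
  have "y2 \<noteq> y1" "y0 \<noteq> y5" "y0 \<noteq> y1" "y5 \<noteq> y4" "y4 \<noteq> y3" 
    using nz \<open>f \<noteq> 0\<close> unfolding abc f by auto
  then have "cross_ratio (M x4) (M x5) (M x0) (M x3) = Fin t4"
    "cross_ratio (M x5) (M x0) (M x1) (M x4) = Fin t5"
    "cross_ratio (M x0) (M x1) (M x2) (M x5) = Fin t0"
    unfolding y cross_ratio_Fin_iff eqs t' using nz \<open>f \<noteq> 0\<close> by auto
  then show "cross_ratio x4 x5 x0 x3 = Fin t4" "cross_ratio x5 x0 x1 x4 = Fin t5"
    "cross_ratio x0 x1 x2 x5 = Fin t0"
    unfolding cross_ratio_moebius[OF M] .
qed

section \<open>Transport of stars along edges\<close>

text \<open>A star lists the image of a vertex and the images of its neighbours along the edge classes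
  \<open>1, 2, 3\<close>, which is their counterclockwise order.\<close>

type_synonym star = "csphere \<times> csphere \<times> csphere \<times> csphere"

definition stars :: "complex \<Rightarrow> star set" where
  "stars S = {(p, a1, a2, a3). cross_ratio a1 a2 p a3 = Fin S}"

text \<open>Along an edge of class \<open>j\<close> the two ends exchange their roles. A hexagon beside the edge
  contains one further neighbour of each end, and these two belong to the two different remaining
  classes; this is why the arguments \<open>a1, a2, a3\<close> appear crosswise.\<close>

fun edge_step :: "nat \<Rightarrow> csphere \<Rightarrow> star \<Rightarrow> star" where
  "edge_step j t (p, a1, a2, a3) =
     (if j = 1 then (a1, p, fourth p a1 a3 t, fourth p a1 a2 t)
      else if j = 2 then (a2, fourth p a2 a3 t, p, fourth p a2 a1 t)
      else (a3, fourth p a3 a2 t, fourth p a3 a1 t, p))"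

lemma in_stars: "(p, a1, a2, a3) \<in> stars S \<longleftrightarrow> cross_ratio a1 a2 p a3 = Fin S"
  by (simp add: stars_def)

text \<open>The second and third equation hold because the cross-ratio of an edge is the same when the edge
  is traversed backwards.\<close>

lemma star_step:
  assumes s: "cross_ratio q a p b = Fin s" "s \<noteq> 0" "s \<noteq> 1" and t: "t \<noteq> 1"
  shows "cross_ratio p (fourth p q b (Fin t)) q (fourth p q a (Fin t)) = Fin s"
    and "fourth q p (fourth p q a (Fin t)) (Fin t) = a"
    and "fourth q p (fourth p q b (Fin t)) (Fin t) = b"
proof -
  note d = cross_ratio_all_distinct[OF s]
  define a' b' where "a' = fourth p q a (Fin t)" and "b' = fourth p q b (Fin t)"
  have ta: "cross_ratio p q a' a = Fin t" and tb: "cross_ratio p q b' b = Fin t"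
    using fourth_eq_iff[of p q a "Fin t" a'] fourth_eq_iff[of p q b "Fin t" b'] d a'_def b'_def
    by auto
  show s': "cross_ratio p b' q a' = Fin s" by (rule star_transfer[OF s ta tb t])
  note d' = cross_ratio_all_distinct[OF s' s(2,3)]
  show "fourth q p a' (Fin t) = a" "fourth q p b' (Fin t) = b"
    using ta tb d' by (auto simp: fourth_eq_iff cross_ratio_reverse[of q p])
qed

lemma
  assumes S: "S \<noteq> 0" "S \<noteq> 1" and x: "x \<in> stars S" and t: "t \<noteq> 1"
  shows edge_step_in_stars: "edge_step j (Fin t) x \<in> stars S"
    and edge_step_involution: "edge_step j (Fin t) (edge_step j (Fin t) x) = x"
proof -
  obtain p a1 a2 a3 where x_def: "x = (p, a1, a2, a3)" by (metis prod_cases4)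
  have s1: "cross_ratio a1 a2 p a3 = Fin S" using x unfolding x_def in_stars .
  have s2: "cross_ratio a2 a3 p a1 = Fin (1 - 1 / S)"
    and s3: "cross_ratio a3 a1 p a2 = Fin (1 / (1 - S))"
    using s1 cross_ratio_rotate_iff[OF S] by blast+
  have S2: "1 - 1 / S \<noteq> 0" "1 - 1 / S \<noteq> 1" and S3: "1 / (1 - S) \<noteq> 0" "1 / (1 - S) \<noteq> 1"
    using S by (simp_all add: field_simps)
  note r1 = star_step[OF s1 S t] and r2 = star_step[OF s2 S2 t] and r3 = star_step[OF s3 S3 t]
  show "edge_step j (Fin t) x \<in> stars S"
    using r1(1) cross_ratio_rotate_iff(1)[OF S] r2(1) cross_ratio_rotate_iff(2)[OF S] r3(1)
    unfolding x_def by (auto simp: in_stars)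
  show "edge_step j (Fin t) (edge_step j (Fin t) x) = x"
    unfolding x_def using r1(2,3) r2(2,3) r3(2,3) by auto
qed

text \<open>The two sides transport the star at the vertex \<open>w3\<close> of a hexagon \<open>w1, \<dots>, w6\<close> along both
  ways to the opposite vertex \<open>w6\<close>. The left way constructs \<open>w5, w6, w1\<close>, and \<open>hexagon_closes\<close>
  shows that the right way constructs the same points. The neighbour of \<open>w6\<close> outside the hexagon then
  agrees as well, since \<open>S\<close> determines it from the other three points.\<close>

lemma edge_steps_close:
  assumes S: "S \<noteq> 0" "S \<noteq> 1" and x: "x \<in> stars S"
    and rel: "hex_relation t3 t4 t5 t6 t1 t2"
    and t: "t1 \<noteq> 1" "t2 \<noteq> 1" "t3 \<noteq> 1" "t4 \<noteq> 1" "t5 \<noteq> 1" "t6 \<noteq> 1"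
  shows "edge_step 3 (Fin t5) (edge_step 1 (Fin t4) (edge_step 2 (Fin t3) x)) =
         edge_step 2 (Fin t6) (edge_step 1 (Fin t1) (edge_step 3 (Fin t2) x))"
    (is "?L = ?R")
proof -
  have inL: "?L \<in> stars S" and inR: "?R \<in> stars S"
    using edge_step_in_stars[OF S] x t by auto
  obtain w3 u3 w4 w2 where x_def: "x = (w3, u3, w4, w2)" by (metis prod_cases4)
  have X: "cross_ratio u3 w4 w3 w2 = Fin S" using x unfolding x_def in_stars .
  note dX = cross_ratio_all_distinct[OF X S]
  define w5 where "w5 = fourth w3 w4 w2 (Fin t3)"
  define u4 where "u4 = fourth w3 w4 u3 (Fin t3)"
  have x4: "edge_step 2 (Fin t3) x = (w4, w5, w3, u4)"
    unfolding x_def w5_def u4_def by simp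
  have X4: "cross_ratio w5 w3 w4 u4 = Fin S"
    using edge_step_in_stars[OF S x t(3), of 2] unfolding x4 in_stars .
  note dX4 = cross_ratio_all_distinct[OF X4 S]
  define w6 where "w6 = fourth w4 w5 w3 (Fin t4)"
  define u5 where "u5 = fourth w4 w5 u4 (Fin t4)"
  have x5: "edge_step 1 (Fin t4) (w4, w5, w3, u4) = (w5, w4, u5, w6)"
    unfolding w6_def u5_def by simp
  have X5: "cross_ratio w4 u5 w5 w6 = Fin S"
    using edge_step_in_stars[OF S, of "(w4, w5, w3, u4)" t4 1] X4 t unfolding x5 in_stars by auto
  note dX5 = cross_ratio_all_distinct[OF X5 S]
  define w1 where "w1 = fourth w5 w6 w4 (Fin t5)"
  have L: "?L = (w6, fourth w5 w6 u5 (Fin t5), w1, w5)"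
    unfolding x4 x5 w1_def by simp
  have e3: "cross_ratio w3 w4 w5 w2 = Fin t3" using w5_def fourth_eq_iff[of w3 w4 w2] dX by auto
  have e4: "cross_ratio w4 w5 w6 w3 = Fin t4" using w6_def fourth_eq_iff[of w4 w5 w3] dX4 by auto
  have e5: "cross_ratio w5 w6 w1 w4 = Fin t5" using w1_def fourth_eq_iff[of w5 w6 w4] dX5 by auto
  have "w6 \<noteq> w1" using e5 by (auto simp: cross_ratio_eq_Fin_iff)
  then have e6: "cross_ratio w6 w1 w2 w5 = Fin t6" and e1: "cross_ratio w1 w2 w3 w6 = Fin t1"
    and e2: "cross_ratio w2 w3 w4 w1 = Fin t2"
    using hexagon_closes[OF rel e3 e4 e5] dX by auto
  have d1: "w2 \<noteq> w1" "w3 \<noteq> w1" using cross_ratio_distinct[OF e2 t(2)] e1 e2 dX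
    by (auto simp: cross_ratio_eq_Fin_iff)
  have d6: "w1 \<noteq> w6" "w2 \<noteq> w6" using cross_ratio_distinct[OF e1 t(1)] d1 \<open>w6 \<noteq> w1\<close>
    by (auto simp: cross_ratio_eq_Fin_iff)
  have w1: "fourth w3 w2 w4 (Fin t2) = w1"
    using e2 dX by (auto simp: fourth_eq_iff cross_ratio_reverse[of w3 w2])
  have w6: "fourth w2 w1 w3 (Fin t1) = w6"
    using e1 dX d1 by (auto simp: fourth_eq_iff cross_ratio_reverse[of w2 w1])
  have w5: "fourth w1 w6 w2 (Fin t6) = w5"
    using e6 d1 d6 by (auto simp: fourth_eq_iff cross_ratio_reverse[of w1 w6])
  obtain v where R: "?R = (w6, v, w1, w5)"
    unfolding x_def by (simp add: w1 w6 w5)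
  let ?v' = "fourth w5 w6 u5 (Fin t5)"
  have v: "cross_ratio v w1 w6 w5 = Fin S" "cross_ratio ?v' w1 w6 w5 = Fin S"
    using inR inL unfolding R L in_stars by auto
  have "w5 \<noteq> w6" using dX5 by auto
  have "cross_ratio w6 w5 u w1 = cross_ratio u w1 w6 w5" for u
    by (rule cross_ratio_swap_pairs)
  then have "v = ?v'"
    using cross_ratio_bij[of w6 w5 w1 "Fin S"] v cross_ratio_all_distinct[OF v(1) S] by metis
  then show ?thesis unfolding L R by simp
qed

section \<open>Coordinates on the hexagonal lattice\<close>

lemma eps_eq: "\<epsilon> = Complex (1 / 2) (sqrt 3 / 2)"
proof -
  have "\<epsilon> = cis (pi / 3)"
    unfolding \<epsilon>_def cis_conv_exp by (simp add: mult.commute)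
  then show ?thesis by (simp add: complex_eq_iff cos_60 sin_60)
qed

lemma eps_sq: "\<epsilon> * \<epsilon> = \<epsilon> - 1"
  unfolding eps_eq by (simp add: complex_eq_iff)

lemma omega_eq: "\<omega> = \<epsilon> - 1"
proof -
  have "\<omega> = \<epsilon> * \<epsilon>"
  proof -
    have "2 * pi * \<i> / 3 = pi * \<i> / 3 + pi * \<i> / 3" by simp
    then show ?thesis unfolding \<omega>_def \<epsilon>_def by (simp only: exp_add)
  qed
  then show ?thesis using eps_sq by simp
qed

lemma eps_omega: "\<epsilon> = 1 + \<omega>"
  by (simp add: omega_eq)

lemma omega_sq: "\<omega>\<^sup>2 = - 1 - \<omega>"
  using eps_sq unfolding omega_eq power2_eq_square by (simp add: algebra_simps)

lemma omega_mult: "\<omega> * \<omega> = - 1 - \<omega>"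
  using omega_sq by (simp add: power2_eq_square)

lemma omega_mult_left: "\<omega> * (\<omega> * x) = - x - \<omega> * x"
  unfolding mult.assoc[symmetric] omega_mult by (simp add: algebra_simps)

lemma norm_eps [simp]: "norm \<epsilon> = 1"
  unfolding eps_eq by (simp add: cmod_def power_divide)

lemma eps_nonzero [simp]: "\<epsilon> \<noteq> 0"
  using norm_eps by force

lemma norm_omega [simp]: "norm \<omega> = 1"
proof -
  have "\<omega> = \<epsilon> * \<epsilon>" by (simp add: omega_eq eps_sq)
  then show ?thesis by (metis mult_1 norm_eps norm_mult)
qed

lemma omega_coordinates:
  assumes "of_int x + of_int y * \<omega> = of_int x' + of_int y' * \<omega>"
  shows "x = x'" "y = y'"
proof -
  have "Im (of_int x + of_int y * \<omega>) = of_int y * (sqrt 3 / 2)" for x y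
    by (simp add: omega_eq eps_eq)
  then have "of_int y * (sqrt 3 / 2) = of_int y' * (sqrt 3 / 2)" using assms by metis
  then show "y = y'" by simp
  then show "x = x'" using assms by simp
qed

text \<open>As \<open>1 + \<omega> + \<omega>\<^sup>2 = 0\<close>, the residue of \<open>k + l + m\<close> modulo 3 can be read off from the coordinates
  with respect to \<open>1\<close> and \<open>\<omega>\<close>. Class \<open>0\<close> consists of the face centers. Vertices of class \<open>1\<close>
  have their neighbours at \<open>z + 1\<close>, \<open>z + \<omega>\<close>, \<open>z + \<omega>\<^sup>2\<close>, vertices of class \<open>2\<close> at \<open>z - 1\<close>,
  \<open>z - \<omega>\<close>, \<open>z - \<omega>\<^sup>2\<close>. Every edge therefore has exactly one end in class \<open>1\<close>.\<close>

definition lattice_class :: "int \<Rightarrow> complex set" where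
  "lattice_class r = {of_int x + of_int y * \<omega> | x y. (x + y) mod 3 = r mod 3}"

lemma lattice_class_cong: "r mod 3 = s mod 3 \<Longrightarrow> lattice_class r = lattice_class s"
  by (simp add: lattice_class_def)

lemma lattice_class_disjoint:
  assumes "z \<in> lattice_class r" "z \<in> lattice_class s"
  shows "r mod 3 = s mod 3"
  using assms omega_coordinates unfolding lattice_class_def by fastforce

lemma lattice_class_add:
  assumes "z \<in> lattice_class r" "u \<in> lattice_class s"
  shows "z + u \<in> lattice_class (r + s)"
proof -
  obtain x y where z: "z = of_int x + of_int y * \<omega>" "(x + y) mod 3 = r mod 3"
    using assms unfolding lattice_class_def by auto
  obtain x' y' where u: "u = of_int x' + of_int y' * \<omega>" "(x' + y') mod 3 = s mod 3"
    using assms unfolding lattice_class_def by auto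
  have "z + u = of_int (x + x') + of_int (y + y') * \<omega>"
    unfolding z u by (simp add: algebra_simps)
  moreover have "((x + x') + (y + y')) mod 3 = (r + s) mod 3"
    using mod_add_cong[OF z(2) u(2)] by (simp add: ac_simps)
  ultimately show ?thesis unfolding lattice_class_def by blast
qed

lemma lattice_class_uminus:
  assumes "u \<in> lattice_class s"
  shows "- u \<in> lattice_class (- s)"
proof -
  obtain x y where u: "u = of_int x + of_int y * \<omega>" "(x + y) mod 3 = s mod 3"
    using assms unfolding lattice_class_def by auto
  have "- u = of_int (- x) + of_int (- y) * \<omega>"
    unfolding u by simp
  moreover have "(- x + - y) mod 3 = (- s) mod 3"
    using mod_minus_cong[OF u(2)] by simp
  ultimately show ?thesis unfolding lattice_class_def by blast
qed

lemma lattice_class_diff: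
  assumes "z \<in> lattice_class r" "u \<in> lattice_class s"
  shows "z - u \<in> lattice_class (r - s)"
  using lattice_class_add[OF assms(1) lattice_class_uminus[OF assms(2)]] by simp

lemma lattice_class_units: "1 \<in> lattice_class 1" "\<omega> \<in> lattice_class 1" "\<omega>\<^sup>2 \<in> lattice_class 1"
proof -
  have I: "of_int x + of_int y * \<omega> \<in> lattice_class r" if "(x + y) mod 3 = r mod 3" for x y r
    using that unfolding lattice_class_def by blast
  show "1 \<in> lattice_class 1" "\<omega> \<in> lattice_class 1" "\<omega>\<^sup>2 \<in> lattice_class 1"
    using I[of 1 0 1] I[of 0 1 1] I[of "- 1" "- 1" 1] omega_sq by simp_all
qed

lemma hex_lattice_normal_form:
  "of_int k + of_int l * \<omega> + of_int m * \<omega>\<^sup>2 = of_int (k - m) + of_int (l - m) * \<omega>"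
  "((k - m) + (l - m)) mod 3 = (k + l + m) mod 3" for k l m :: int
proof -
  show "of_int k + of_int l * \<omega> + of_int m * \<omega>\<^sup>2 = of_int (k - m) + of_int (l - m) * \<omega>"
    unfolding omega_sq by (simp add: algebra_simps)
  have "(k - m) + (l - m) = (k + l + m) + (- m) * 3" by simp
  then show "((k - m) + (l - m)) mod 3 = (k + l + m) mod 3" by (simp only: mod_mult_self1)
qed

lemma hex_F_eq: "hex_F = lattice_class 0"
proof (intro equalityI subsetI)
  fix z assume "z \<in> hex_F"
  then obtain k l m where "z = of_int (k - m) + of_int (l - m) * \<omega>" "(k + l + m) mod 3 = 0"
    unfolding hex_F_def hex_lattice_normal_form(1) by auto
  moreover have "((k - m) + (l - m)) mod 3 = 0 mod 3"
    using calculation(2) hex_lattice_normal_form(2)[of k m l] by simp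
  ultimately show "z \<in> lattice_class 0" unfolding lattice_class_def by blast
next
  fix z assume "z \<in> lattice_class 0"
  then obtain x y where "z = of_int x + of_int y * \<omega> + of_int 0 * \<omega>\<^sup>2" "(x + y + 0) mod 3 = 0"
    unfolding lattice_class_def by auto
  then show "z \<in> hex_F" unfolding hex_F_def mem_Collect_eq by (intro exI conjI)
qed

lemma hex_V_eq: "hex_V = lattice_class 1 \<union> lattice_class 2"
proof (intro equalityI subsetI)
  fix z assume "z \<in> hex_V"
  then obtain k l m where "z = of_int (k - m) + of_int (l - m) * \<omega>" "(k + l + m) mod 3 \<noteq> 0"
    unfolding hex_V_def hex_lattice_normal_form(1) by auto
  moreover have "((k - m) + (l - m)) mod 3 = 1 mod 3 \<or> ((k - m) + (l - m)) mod 3 = 2 mod 3"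
    unfolding hex_lattice_normal_form(2)
    using calculation(2) pos_mod_bound[of 3 "k + l + m"] pos_mod_sign[of 3 "k + l + m"] by auto
  ultimately show "z \<in> lattice_class 1 \<union> lattice_class 2" unfolding lattice_class_def by blast
next
  fix z assume "z \<in> lattice_class 1 \<union> lattice_class 2"
  then obtain x y where "z = of_int x + of_int y * \<omega> + of_int 0 * \<omega>\<^sup>2" "(x + y + 0) mod 3 \<noteq> 0"
    unfolding lattice_class_def by auto
  then show "z \<in> hex_V" unfolding hex_V_def mem_Collect_eq by (intro exI conjI)
qed

lemma lattice_class_0_not_V: "z \<in> lattice_class 0 \<Longrightarrow> z \<notin> hex_V"
  unfolding hex_V_eq using lattice_class_disjoint[of z 0 1] lattice_class_disjoint[of z 0 2] by auto

lemma omega_power_class: "j \<in> {1, 2, 3 :: nat} \<Longrightarrow> \<omega> ^ (j - 1) \<in> lattice_class 1"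
  using lattice_class_units by auto

lemma lattice_class_neighbours:
  assumes "d \<in> lattice_class 1"
  shows "z \<in> lattice_class 1 \<Longrightarrow> z + d \<in> lattice_class 2"
    "z \<in> lattice_class 1 \<Longrightarrow> z - d \<in> lattice_class 0"
    "z \<in> lattice_class 2 \<Longrightarrow> z - d \<in> lattice_class 1"
    "z \<in> lattice_class 2 \<Longrightarrow> z + d \<in> lattice_class 0"
    "z \<in> lattice_class 0 \<Longrightarrow> z + d \<in> lattice_class 1"
    "z \<in> lattice_class 0 \<Longrightarrow> z - d \<in> lattice_class 2"
  using lattice_class_add[OF _ assms] lattice_class_diff[OF _ assms]
    lattice_class_cong[of 3 0] lattice_class_cong[of "- 1" 2]
  by force+

lemma hex_Ecl_iff:
  "{a, b} \<in> hex_Ecl j \<longleftrightarrow>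
     a \<in> hex_V \<and> b \<in> hex_V \<and> (b - a = \<omega> ^ (j - 1) \<or> b - a = - (\<omega> ^ (j - 1)))"
    (is "_ \<longleftrightarrow> ?R a b")
proof
  assume "{a, b} \<in> hex_Ecl j"
  then obtain a' b' where *: "{a, b} = {a', b'}" "{a', b'} \<in> hex_E"
     "b' - a' = \<omega> ^ (j - 1) \<or> b' - a' = - (\<omega> ^ (j - 1))"
    unfolding hex_Ecl_def by blast
  have V: "a \<in> hex_V" "b \<in> hex_V" using *(1,2) unfolding hex_E_def by (auto simp: doubleton_eq_iff)
  have "(a = a' \<and> b = b') \<or> (a = b' \<and> b = a')" using *(1) by (auto simp: doubleton_eq_iff)
  then show "?R a b" using *(3) V by (auto simp: algebra_simps)
next
  assume R: "?R a b"
  then have "norm (b - a) = 1" by (auto simp: norm_power)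
  then have "dist a b = 1" by (simp add: dist_norm norm_minus_commute)
  with R show "{a, b} \<in> hex_Ecl j" unfolding hex_Ecl_def hex_E_def by blast
qed

lemma edge_at_vertex_iff:
  assumes "j \<in> {1, 2, 3}"
  shows "z \<in> lattice_class 1 \<Longrightarrow> {z', z} \<in> hex_Ecl j \<longleftrightarrow> z' = z + \<omega> ^ (j - 1)"
    and "z \<in> lattice_class 2 \<Longrightarrow> {z', z} \<in> hex_Ecl j \<longleftrightarrow> z' = z - \<omega> ^ (j - 1)"
proof -
  note n = lattice_class_neighbours[OF omega_power_class[OF assms]]
  show "{z', z} \<in> hex_Ecl j \<longleftrightarrow> z' = z + \<omega> ^ (j - 1)" if z: "z \<in> lattice_class 1"
  proof -
    have "z - \<omega> ^ (j - 1) \<notin> hex_V" using n(2)[OF z] lattice_class_0_not_V by blast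
    moreover have "z + \<omega> ^ (j - 1) \<in> hex_V" "z \<in> hex_V" using n(1)[OF z] z hex_V_eq by auto
    moreover have "z - z' = \<omega> ^ (j - 1) \<longleftrightarrow> z' = z - \<omega> ^ (j - 1)"
      "z - z' = - (\<omega> ^ (j - 1)) \<longleftrightarrow> z' = z + \<omega> ^ (j - 1)" by (auto simp: algebra_simps)
    ultimately show ?thesis unfolding hex_Ecl_iff by blast
  qed
  show "{z', z} \<in> hex_Ecl j \<longleftrightarrow> z' = z - \<omega> ^ (j - 1)" if z: "z \<in> lattice_class 2"
  proof -
    have "z + \<omega> ^ (j - 1) \<notin> hex_V" using n(4)[OF z] lattice_class_0_not_V by blast
    moreover have "z - \<omega> ^ (j - 1) \<in> hex_V" "z \<in> hex_V" using n(3)[OF z] z hex_V_eq by auto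
    moreover have "z - z' = \<omega> ^ (j - 1) \<longleftrightarrow> z' = z - \<omega> ^ (j - 1)"
      "z - z' = - (\<omega> ^ (j - 1)) \<longleftrightarrow> z' = z + \<omega> ^ (j - 1)" by (auto simp: algebra_simps)
    ultimately show ?thesis unfolding hex_Ecl_iff by blast
  qed
qed

section \<open>The stars of a map on the vertices\<close>

definition star_at :: "(complex \<Rightarrow> csphere) \<Rightarrow> complex \<Rightarrow> star" where
  "star_at w z =
     (if z \<in> lattice_class 1 then (w z, w (z + 1), w (z + \<omega>), w (z + \<omega>\<^sup>2))
      else (w z, w (z - 1), w (z - \<omega>), w (z - \<omega>\<^sup>2)))"

lemma star_at_simps:
  "z \<in> lattice_class 1 \<Longrightarrow> star_at w z = (w z, w (z + 1), w (z + \<omega>), w (z + \<omega>\<^sup>2))"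
  "z \<in> lattice_class 2 \<Longrightarrow> star_at w z = (w z, w (z - 1), w (z - \<omega>), w (z - \<omega>\<^sup>2))"
  using lattice_class_disjoint[of z 1 2] by (auto simp: star_at_def)

lemma has_constant_S_iff: "has_constant_S w S \<longleftrightarrow> (\<forall>z\<in>hex_V. star_at w z \<in> stars S)"
proof -
  have "(\<forall>z1 z2 z3. {z1, z} \<in> hex_Ecl 1 \<and> {z2, z} \<in> hex_Ecl 2 \<and> {z3, z} \<in> hex_Ecl 3 \<longrightarrow>
        cross_ratio (w z1) (w z2) (w z) (w z3) = Fin S) \<longleftrightarrow> star_at w z \<in> stars S"
    if "z \<in> hex_V" for z
    using that unfolding hex_V_eq
    by (auto simp: edge_at_vertex_iff star_at_simps in_stars)
  then show ?thesis unfolding has_constant_S_def by blast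
qed

text \<open>The cross-ratio of a star when its neighbours are listed counterclockwise from the edge of
  class \<open>j\<close> on, see \<open>cross_ratio_rotate_iff\<close>.\<close>

definition class_S :: "complex \<Rightarrow> nat \<Rightarrow> complex" where
  "class_S S j = (if j = 1 then S else if j = 2 then 1 - 1 / S else 1 / (1 - S))"

lemma class_S_nontrivial:
  assumes "S \<noteq> 0" "S \<noteq> 1"
  shows "class_S S j \<noteq> 0" "class_S S j \<noteq> 1"
  using assms by (auto simp: class_S_def field_simps)

lemma omega_cubed: "\<omega> * \<omega>\<^sup>2 = 1" "\<omega>\<^sup>2 * \<omega> = 1" "\<omega> ^ 4 = \<omega>"
proof -
  show *: "\<omega> * \<omega>\<^sup>2 = 1" "\<omega>\<^sup>2 * \<omega> = 1"
    unfolding omega_sq by (simp_all add: algebra_simps omega_mult)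
  show "\<omega> ^ 4 = \<omega>" using * by (simp add: eval_nat_numeral)
qed

lemma star_cross_ratio:
  assumes w: "has_constant_S w S" and S: "S \<noteq> 0" "S \<noteq> 1"
    and j: "j \<in> {1, 2, 3}" and e: "{z + d, z} \<in> hex_Ecl j"
  shows "cross_ratio (w (z + d)) (w (z + \<omega> * d)) (w z) (w (z + \<omega>\<^sup>2 * d)) = Fin (class_S S j)"
proof -
  note rot = cross_ratio_rotate_iff[OF S]
  have V: "z \<in> hex_V" using e hex_Ecl_iff by blast
  then have st: "star_at w z \<in> stars S" using w has_constant_S_iff by blast
  consider "z \<in> lattice_class 1" | "z \<in> lattice_class 2" using V hex_V_eq by auto
  then show ?thesis
  proof cases
    case 1
    then have d: "d = \<omega> ^ (j - 1)" using edge_at_vertex_iff(1)[OF j] e by force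
    have "cross_ratio (w (z + 1)) (w (z + \<omega>)) (w z) (w (z + \<omega>\<^sup>2)) = Fin S"
      using st unfolding star_at_simps(1)[OF 1] in_stars .
    then show ?thesis
      using j rot unfolding d
      by (auto simp: class_S_def omega_cubed power2_eq_square[symmetric])
  next
    case 2
    then have d: "d = - (\<omega> ^ (j - 1))" using edge_at_vertex_iff(2)[OF j, of z "z + d"] e
      by (simp add: algebra_simps eq_neg_iff_add_eq_0)
    have "cross_ratio (w (z - 1)) (w (z - \<omega>)) (w z) (w (z - \<omega>\<^sup>2)) = Fin S"
      using st unfolding star_at_simps(2)[OF 2] in_stars .
    then show ?thesis
      using j rot unfolding d
      by (auto simp: class_S_def omega_cubed power2_eq_square[symmetric])
  qed
qed

section \<open>Edge cross-ratios of a map with constant S\<close>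

lemma eps_powi_add:
  "\<epsilon> powi (i + 1) = \<epsilon> powi i * (1 + \<omega>)" "\<epsilon> powi (i + 2) = \<epsilon> powi i * \<omega>"
  "\<epsilon> powi (i + 3) = - (\<epsilon> powi i)" "\<epsilon> powi (i + 4) = - (\<epsilon> powi i * (1 + \<omega>))"
  "\<epsilon> powi (i + 5) = - (\<epsilon> powi i * \<omega>)" "\<epsilon> powi (i + 6) = \<epsilon> powi i"
  "\<epsilon> powi (i - 1) = - (\<epsilon> powi i * \<omega>)"
proof -
  have 1: "\<epsilon> powi (k + 1) = \<epsilon> powi k * (1 + \<omega>)" for k
    by (simp add: power_int_add eps_omega[symmetric])
  have 2: "\<epsilon> powi (k + 2) = \<epsilon> powi k * \<omega>" for k
  proof -
    have "(1 + \<omega>) * (1 + \<omega>) = \<omega>" by (simp add: algebra_simps omega_mult)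
    then show ?thesis using 1[of "k + 1"] unfolding 1[of k] by (simp add: mult.assoc add.commute)
  qed
  have 3: "\<epsilon> powi (k + 3) = - (\<epsilon> powi k)" for k
  proof -
    have "\<omega> * (1 + \<omega>) = - 1" by (simp add: algebra_simps omega_mult)
    then show ?thesis using 1[of "k + 2"] unfolding 2[of k] by (simp add: mult.assoc add.commute)
  qed
  show "\<epsilon> powi (i + 1) = \<epsilon> powi i * (1 + \<omega>)" "\<epsilon> powi (i + 2) = \<epsilon> powi i * \<omega>"
    "\<epsilon> powi (i + 3) = - (\<epsilon> powi i)" by (rule 1 2 3)+
  show "\<epsilon> powi (i + 4) = - (\<epsilon> powi i * (1 + \<omega>))" "\<epsilon> powi (i + 5) = - (\<epsilon> powi i * \<omega>)"
    "\<epsilon> powi (i + 6) = \<epsilon> powi i"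
    using 3[of "i + 1"] 3[of "i + 2"] 3[of "i + 3"] 1[of i] 2[of i] 3[of i]
    by (simp_all add: add.assoc)
  show "\<epsilon> powi (i - 1) = - (\<epsilon> powi i * \<omega>)"
    using 3[of "i - 1"] 2[of i] by (simp add: algebra_simps)
qed

lemma eps_powi_mod: "\<epsilon> powi (i mod 6) = \<epsilon> powi i"
proof -
  have "\<epsilon> powi 6 = 1" using eps_powi_add(6)[of 0] by simp
  then have "\<epsilon> powi (6 * (i div 6)) = 1" by (simp add: power_int_mult)
  then have "\<epsilon> powi (6 * (i div 6) + i mod 6) = \<epsilon> powi (i mod 6)"
    by (subst power_int_add) simp_all
  then show ?thesis by simp
qed

lemma mod_6_cases:
  fixes i :: int
  obtains "i mod 6 = 0" | "i mod 6 = 1" | "i mod 6 = 2" | "i mod 6 = 3" | "i mod 6 = 4" | "i mod 6 = 5"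
proof -
  have "0 \<le> i mod 6" "i mod 6 < 6" by simp_all
  then show ?thesis using that by linarith
qed

lemma eps_powi_values:
  "\<epsilon> powi 0 = 1" "\<epsilon> powi 1 = - (\<omega>\<^sup>2)" "\<epsilon> powi 2 = \<omega>" "\<epsilon> powi 3 = - 1" "\<epsilon> powi 4 = \<omega>\<^sup>2"
  "\<epsilon> powi 5 = - \<omega>"
proof -
  show "\<epsilon> powi 0 = 1" "\<epsilon> powi 2 = \<omega>" "\<epsilon> powi 3 = - 1" "\<epsilon> powi 5 = - \<omega>"
    using eps_powi_add[of 0] by simp_all
  show "\<epsilon> powi 1 = - (\<omega>\<^sup>2)" "\<epsilon> powi 4 = \<omega>\<^sup>2"
    using eps_powi_add(4)[of 0] by (simp_all add: omega_sq eps_omega)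
qed

lemma eps_powi_direction:
  obtains j where "j \<in> {1, 2, 3 :: nat}" "\<epsilon> powi i = \<omega> ^ (j - 1) \<or> \<epsilon> powi i = - (\<omega> ^ (j - 1))"
proof -
  have "\<epsilon> powi i \<in> {1, \<omega>, \<omega>\<^sup>2} \<or> \<epsilon> powi i \<in> {- 1, - \<omega>, - (\<omega>\<^sup>2)}"
    by (subst (1 2) eps_powi_mod[symmetric], rule mod_6_cases[of i])
      (simp_all only: eps_powi_values, simp_all)
  then show ?thesis using that[of 1] that[of 2] that[of 3] by auto
qed

lemma hex_vertex_in_V:
  assumes "c \<in> hex_F"
  shows "hex_vertex c i \<in> hex_V"
proof -
  obtain j where j: "j \<in> {1, 2, 3 :: nat}" "\<epsilon> powi i = \<omega> ^ (j - 1) \<or> \<epsilon> powi i = - (\<omega> ^ (j - 1))"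
    by (rule eps_powi_direction)
  then show ?thesis
    using lattice_class_neighbours(5,6)[OF omega_power_class[OF j(1)], of c] assms
    unfolding hex_vertex_def hex_F_eq hex_V_eq by auto
qed

lemma hex_vertex_Suc: "hex_vertex c (i + 1) = hex_vertex c i + \<epsilon> powi (i + 2)"
  unfolding hex_vertex_def eps_powi_add by (simp add: algebra_simps)

lemma hex_vertex_6: "hex_vertex c (i + 6) = hex_vertex c i"
  unfolding hex_vertex_def eps_powi_add by simp

lemma hex_edge_class:
  assumes "c \<in> hex_F"
  obtains j where "j \<in> {1, 2, 3}" "hex_edge c i \<in> hex_Ecl j"
proof -
  obtain j where j: "j \<in> {1, 2, 3 :: nat}"
    "\<epsilon> powi (i + 2) = \<omega> ^ (j - 1) \<or> \<epsilon> powi (i + 2) = - (\<omega> ^ (j - 1))"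
    by (rule eps_powi_direction)
  have "hex_vertex c (i + 1) - hex_vertex c i = \<epsilon> powi (i + 2)" by (simp add: hex_vertex_Suc)
  then have "hex_edge c i \<in> hex_Ecl j"
    unfolding hex_edge_def hex_Ecl_iff using j hex_vertex_in_V[OF assms] by auto
  then show ?thesis using that j by blast
qed

text \<open>Two hexagons share an edge only if they are mirror images in it, and then they run through
  the edge in opposite directions.\<close>

lemma hex_edge_eqD:
  assumes "hex_edge c i = hex_edge c' i'"
  shows "c = c' \<and> \<epsilon> powi i = \<epsilon> powi i' \<or>
    c' = c + \<epsilon> powi i * (2 + \<omega>) \<and> \<epsilon> powi i' = - (\<epsilon> powi i)"
proof -
  have nz: "\<omega> \<noteq> 0" using norm_omega by force
  let ?E = "\<epsilon> powi i" and ?E' = "\<epsilon> powi i'"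
  have "(c + ?E = c' + ?E' \<and> c + ?E * (1 + \<omega>) = c' + ?E' * (1 + \<omega>)) \<or>
    (c + ?E = c' + ?E' * (1 + \<omega>) \<and> c + ?E * (1 + \<omega>) = c' + ?E')"
    using assms unfolding hex_edge_def hex_vertex_def eps_powi_add doubleton_eq_iff by blast
  then show ?thesis
  proof
    assume *: "c + ?E = c' + ?E' \<and> c + ?E * (1 + \<omega>) = c' + ?E' * (1 + \<omega>)"
    have "(c + ?E * (1 + \<omega>)) - (c + ?E) = (c' + ?E' * (1 + \<omega>)) - (c' + ?E')"
      using * by simp
    then have "?E * \<omega> = ?E' * \<omega>" by (simp add: algebra_simps)
    with nz * show ?thesis by auto
  next
    assume *: "c + ?E = c' + ?E' * (1 + \<omega>) \<and> c + ?E * (1 + \<omega>) = c' + ?E'"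
    have "(c + ?E * (1 + \<omega>)) - (c + ?E) = (c' + ?E') - (c' + ?E' * (1 + \<omega>))"
      using * by simp
    then have "?E' * \<omega> = (- ?E) * \<omega>" by (simp add: algebra_simps eq_neg_iff_add_eq_0)
    then have E: "?E' = - ?E" using nz by (metis mult_right_cancel)
    then have "c' = c + ?E * (2 + \<omega>)"
      using * by (simp add: algebra_simps)
    with E show ?thesis by simp
  qed
qed

text \<open>The point \<open>c + 2 * \<epsilon> powi i\<close> is the neighbour of the \<open>i\<close>-th vertex outside the hexagon around \<open>c\<close>.\<close>

lemma opposite_hexagon_vertices:
  assumes "c' = c + \<epsilon> powi i * (2 + \<omega>)" "\<epsilon> powi i' = - (\<epsilon> powi i)"
  shows "hex_vertex c' (i' - 1) = c + 2 * \<epsilon> powi (i + 1)" "hex_vertex c' i' = hex_vertex c (i + 1)"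
    "hex_vertex c' (i' + 1) = hex_vertex c i" "hex_vertex c' (i' + 2) = c + 2 * \<epsilon> powi i"
    "c' + 2 * \<epsilon> powi i' = hex_vertex c (i + 2)"
  unfolding hex_vertex_def eps_powi_add assms by (simp_all add: algebra_simps)

lemma spoke_cross_ratio:
  assumes w: "has_constant_S w S" and S: "S \<noteq> 0" "S \<noteq> 1"
    and j: "j \<in> {1, 2, 3}" "hex_edge c i \<in> hex_Ecl j"
  shows "cross_ratio (w (hex_vertex c (i + 1))) (w (hex_vertex c (i - 1))) (w (hex_vertex c i))
    (w (c + 2 * \<epsilon> powi i)) = Fin (class_S S j)"
proof -
  let ?z = "hex_vertex c i" and ?d = "\<epsilon> powi i * \<omega>"
  have z: "?z + ?d = hex_vertex c (i + 1)" "?z + \<omega> * ?d = hex_vertex c (i - 1)"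
    "?z + \<omega>\<^sup>2 * ?d = c + 2 * \<epsilon> powi i"
    unfolding hex_vertex_def eps_powi_add
    by (simp_all add: algebra_simps omega_mult omega_mult_left omega_sq)
  have "{?z + ?d, ?z} \<in> hex_Ecl j" using j(2) unfolding z hex_edge_def by (simp add: insert_commute)
  from star_cross_ratio[OF w S j(1) this] show ?thesis unfolding z .
qed

lemma hexagon_images_distinct:
  assumes w: "has_constant_S w S" and S: "S \<noteq> 0" "S \<noteq> 1" and c: "c \<in> hex_F"
  shows "w (hex_vertex c i) \<noteq> w (hex_vertex c (i + 1))" "w (hex_vertex c i) \<noteq> w (hex_vertex c (i + 2))"
proof -
  have *: "w (hex_vertex c (i + 1)) \<noteq> w (hex_vertex c (i - 1)) \<and>
    w (hex_vertex c (i + 1)) \<noteq> w (hex_vertex c i)" for i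
  proof -
    obtain j where "j \<in> {1, 2, 3}" "hex_edge c i \<in> hex_Ecl j" using hex_edge_class[OF c] .
    from cross_ratio_all_distinct[OF spoke_cross_ratio[OF w S this] class_S_nontrivial[OF S]]
    show ?thesis by auto
  qed
  show "w (hex_vertex c i) \<noteq> w (hex_vertex c (i + 1))" "w (hex_vertex c i) \<noteq> w (hex_vertex c (i + 2))"
    using *[of i, THEN conjunct2, THEN not_sym] *[of "i + 1", THEN conjunct1, THEN not_sym]
    by (simp_all add: add.assoc)
qed

text \<open>Both ends of an edge see the same class, so \<open>spoke_cross_ratio\<close> for the two hexagons gives the
  two equal star cross-ratios that \<open>edge_cross_ratios_agree\<close> asks for.\<close>

lemma edge_cross_ratio_well_defined:
  assumes w: "has_constant_S w S" and S: "S \<noteq> 0" "S \<noteq> 1"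
    and c: "c \<in> hex_F" "hex_edge c i = hex_edge c' i'"
  shows "edge_cross_ratio w c i = edge_cross_ratio w c' i'"
  using hex_edge_eqD[OF c(2)]
proof
  assume "c = c' \<and> \<epsilon> powi i = \<epsilon> powi i'"
  then show ?thesis unfolding edge_cross_ratio_def hex_vertex_def eps_powi_add by simp
next
  assume *: "c' = c + \<epsilon> powi i * (2 + \<omega>) \<and> \<epsilon> powi i' = - (\<epsilon> powi i)"
  note opp = opposite_hexagon_vertices[OF conjunct1[OF *] conjunct2[OF *]]
  obtain j where j: "j \<in> {1, 2, 3}" "hex_edge c i \<in> hex_Ecl j" using hex_edge_class[OF c(1)] .
  have "edge_cross_ratio w c i =
      cross_ratio (w (hex_vertex c i)) (w (hex_vertex c (i + 1)))
        (w (c + 2 * \<epsilon> powi (i + 1))) (w (c + 2 * \<epsilon> powi i))"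
    unfolding edge_cross_ratio_def
  proof (rule edge_cross_ratios_agree)
    show "cross_ratio (w (hex_vertex c (i + 1))) (w (hex_vertex c (i - 1))) (w (hex_vertex c i))
      (w (c + 2 * \<epsilon> powi i)) = Fin (class_S S j)"
      by (rule spoke_cross_ratio[OF w S j])
    show "cross_ratio (w (hex_vertex c i)) (w (c + 2 * \<epsilon> powi (i + 1))) (w (hex_vertex c (i + 1)))
      (w (hex_vertex c (i + 2))) = Fin (class_S S j)"
      using spoke_cross_ratio[OF w S j(1), of c' i'] j(2) c(2) unfolding opp by simp
  qed (use class_S_nontrivial[OF S] in auto)
  also have "\<dots> = edge_cross_ratio w c' i'"
    unfolding edge_cross_ratio_def opp by (rule cross_ratio_reverse)
  finally show ?thesis .
qed

lemma cross_ratio_finite: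
  assumes "z3 \<noteq> z2" "z1 \<noteq> z4"
  obtains t where "cross_ratio z1 z2 z3 z4 = Fin t"
  using assms unfolding cross_ratio_def proj_quot_def by auto

lemma edge_cross_ratios_solve:
  assumes w: "has_constant_S w S" and S: "S \<noteq> 0" "S \<noteq> 1" and T: "has_edge_cross_ratios w T"
  shows "solves_hex T"
  unfolding solves_hex_def
proof (intro ballI allI)
  fix c i assume c: "c \<in> hex_F"
  let ?v = "\<lambda>k. w (hex_vertex c (i + k))"
  note ne = hexagon_images_distinct[OF w S c]
  have per: "?v (k + 6) = ?v k" for k
    using hex_vertex_6[of c "i + k"] by (simp add: add.assoc)
  have ex: "\<exists>t. T (hex_edge c (i + k)) = Fin t \<and>
    cross_ratio (?v k) (?v (k + 1)) (?v (k + 2)) (?v (k - 1)) = Fin t" for k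
  proof -
    have "T (hex_edge c (i + k)) = edge_cross_ratio w c (i + k)"
      using T c by (simp add: has_edge_cross_ratios_def)
    also have "\<dots> = cross_ratio (?v k) (?v (k + 1)) (?v (k + 2)) (?v (k - 1))"
      by (simp only: edge_cross_ratio_def add.assoc add_diff_eq[symmetric])
    finally have "T (hex_edge c (i + k)) = cross_ratio (?v k) (?v (k + 1)) (?v (k + 2)) (?v (k - 1))" .
    moreover have "?v (k + 2) \<noteq> ?v (k + 1)" "?v k \<noteq> ?v (k - 1)"
      using ne(1)[of "i + (k + 1)", THEN not_sym] ne(1)[of "i + (k - 1)", THEN not_sym]
      by (simp_all add: add.assoc)
    ultimately show ?thesis using cross_ratio_finite by metis
  qed
  obtain t where t: "\<And>k. T (hex_edge c (i + k)) = Fin (t k)"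
    "\<And>k. cross_ratio (?v k) (?v (k + 1)) (?v (k + 2)) (?v (k - 1)) = Fin (t k)"
    using ex by metis
  have "hex_relation (t 1) (t 2) (t 3) (t 4) (t 5) (t 6)"
  proof (rule hexagon_relation[of "?v 0" "?v 1" "?v 2" "?v 5" _ "?v 3" _ "?v 4"])
    show "cross_ratio (?v 0) (?v 1) (?v 2) (?v 5) = Fin (t 6)"
      using t(2)[of 6] per[of 0] per[of 1] per[of 2] by simp
    show "cross_ratio (?v 4) (?v 5) (?v 0) (?v 3) = Fin (t 4)"
      using t(2)[of 4] per[of 0] by simp
    show "cross_ratio (?v 5) (?v 0) (?v 1) (?v 4) = Fin (t 5)"
      using t(2)[of 5] per[of 0] per[of 1] by simp
    show "?v 4 \<noteq> ?v 2" "?v 3 \<noteq> ?v 1" using ne(2)[of "i + 2", THEN not_sym] ne(2)[of "i + 1", THEN not_sym]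
      by (simp_all add: add.assoc)
  qed (use t(2)[of 1] t(2)[of 2] t(2)[of 3] in simp_all)
  then show "\<exists>t1 t2 t3 t4 t5 t6.
      T (hex_edge c (i + 1)) = Fin t1 \<and> T (hex_edge c (i + 2)) = Fin t2 \<and>
      T (hex_edge c (i + 3)) = Fin t3 \<and> T (hex_edge c (i + 4)) = Fin t4 \<and>
      T (hex_edge c (i + 5)) = Fin t5 \<and> T (hex_edge c (i + 6)) = Fin t6 \<and>
      hex_relation t1 t2 t3 t4 t5 t6"
    using t(1) by blast
qed

lemma constant_S_edge_cross_ratios:
  assumes w: "has_constant_S w S" and S: "S \<noteq> 0" "S \<noteq> 1"
  obtains T where "has_edge_cross_ratios w T" "solves_hex T"
proof -
  have "\<forall>e. \<exists>t. \<forall>c\<in>hex_F. \<forall>i. hex_edge c i = e \<longrightarrow> edge_cross_ratio w c i = t"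
    using edge_cross_ratio_well_defined[OF w S] by metis
  then obtain T where "\<And>e c i. c \<in> hex_F \<Longrightarrow> hex_edge c i = e \<Longrightarrow> edge_cross_ratio w c i = T e"
    by metis
  then have "has_edge_cross_ratios w T" unfolding has_edge_cross_ratios_def by blast
  then show ?thesis using that edge_cross_ratios_solve[OF w S] by blast
qed

section \<open>Integration over the hexagonal lattice\<close>

lemma int_bi_induct:
  fixes P :: "int \<Rightarrow> bool"
  assumes "P 0" "\<And>n. P n \<longleftrightarrow> P (n + 1)"
  shows "P n"
proof (induction n rule: int_induct[of _ 0])
  case (step2 i)
  then show ?case using assms(2)[of "i - 1"] by simp
qed (use assms in auto)

lemma int_sequence_exists:
  assumes h: "\<And>n x. x \<in> X \<Longrightarrow> h n x \<in> X" "\<And>n x. x \<in> X \<Longrightarrow> g n x \<in> X"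
      "\<And>n x. x \<in> X \<Longrightarrow> h n (g n x) = x" and x0: "x0 \<in> X"
  obtains p :: "int \<Rightarrow> 'a" where "p 0 = x0" "\<And>n. p n \<in> X" "\<And>n. p (n + 1) = h n (p n)"
proof -
  define f where "f = rec_nat x0 (\<lambda>k x. h (int k) x)"
  define b where "b = rec_nat x0 (\<lambda>k x. g (- int k - 1) x)"
  have f: "f 0 = x0" "\<And>k. f (Suc k) = h (int k) (f k)" by (simp_all add: f_def)
  have b: "b 0 = x0" "\<And>k. b (Suc k) = g (- int k - 1) (b k)" by (simp_all add: b_def)
  have fX: "f k \<in> X" for k by (induction k) (simp_all add: f x0 h)
  have bX: "b k \<in> X" for k by (induction k) (simp_all add: b x0 h)
  define p where "p n = (if n \<ge> 0 then f (nat n) else b (nat (- n)))" for n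
  show ?thesis
  proof
    show "p 0 = x0" by (simp add: p_def f)
    show "p n \<in> X" for n by (simp add: p_def fX bX)
    show "p (n + 1) = h n (p n)" for n
    proof (cases "n \<ge> 0")
      case True
      then have "nat (n + 1) = Suc (nat n)" by simp
      then show ?thesis using True by (simp add: p_def f)
    next
      case False
      define k where "k = nat (- n - 1)"
      have n: "n = - int k - 1" "nat (- n) = Suc k" using False by (simp_all add: k_def)
      have "h n (p n) = b k" using False n b(2)[of k] h(3)[OF bX, of n k] by (simp add: p_def)
      moreover have "p (n + 1) = b k"
        using f(1) b(1) by (cases k) (simp_all add: p_def n nat_add_distrib)
      ultimately show ?thesis by simp
    qed
  qed
qed

text \<open>Start with the row \<open>n = 0\<close> and extend every column from it. By flatness the horizontal
  equation in one row is equivalent to that in the next, because the vertical steps are injective.\<close>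

lemma int_grid_exists:
  fixes H U :: "int \<Rightarrow> int \<Rightarrow> 'a \<Rightarrow> 'a"
  assumes H: "\<And>m n x. x \<in> X \<Longrightarrow> H m n x \<in> X" "\<And>m n x. x \<in> X \<Longrightarrow> H' m n x \<in> X"
      "\<And>m n x. x \<in> X \<Longrightarrow> H m n (H' m n x) = x"
    and U: "\<And>m n x. x \<in> X \<Longrightarrow> U m n x \<in> X" "\<And>m n x. x \<in> X \<Longrightarrow> U' m n x \<in> X"
      "\<And>m n x. x \<in> X \<Longrightarrow> U m n (U' m n x) = x" "\<And>m n x. x \<in> X \<Longrightarrow> U' m n (U m n x) = x"
    and flat: "\<And>m n x. x \<in> X \<Longrightarrow> U (m + 1) n (H m n x) = H m (n + 1) (U m n x)"
    and x0: "x0 \<in> X"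
  obtains P where "P 0 0 = x0" "\<And>m n. P m n \<in> X"
    "\<And>m n. P (m + 1) n = H m n (P m n)" "\<And>m n. P m (n + 1) = U m n (P m n)"
proof -
  obtain r where r: "r 0 = x0" "\<And>m. r m \<in> X" "\<And>m. r (m + 1) = H m 0 (r m)"
    using int_sequence_exists[of X "\<lambda>m. H m 0" "\<lambda>m. H' m 0" x0] H x0 by metis
  have "\<forall>m. \<exists>p. p 0 = r m \<and> (\<forall>n. p n \<in> X) \<and> (\<forall>n. p (n + 1) = U m n (p n))"
    using int_sequence_exists[of X "\<lambda>n. U _ n" "\<lambda>n. U' _ n"] U r(2) by metis
  then obtain P where P: "\<And>m. P m 0 = r m" "\<And>m n. P m n \<in> X" "\<And>m n. P m (n + 1) = U m n (P m n)"
    by metis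
  have "P (m + 1) n = H m n (P m n)" for m n
  proof (induction n rule: int_bi_induct)
    case 1
    show ?case using r P by simp
  next
    case (2 n)
    have "P (m + 1) (n + 1) = H m (n + 1) (P m (n + 1)) \<longleftrightarrow>
        U (m + 1) n (P (m + 1) n) = U (m + 1) n (H m n (P m n))"
      using P flat by simp
    also have "\<dots> \<longleftrightarrow> P (m + 1) n = H m n (P m n)"
      using U(4) P(2) H(1) by metis
    finally show ?case by blast
  qed
  then show ?thesis using that P r by metis
qed

text \<open>The end in lattice class \<open>1\<close> of the edge of class 1 with index \<open>(m, n)\<close>. When these edges are
  contracted, the edges of class 2 become the horizontal edges of the square lattice
  (from \<open>cell m n + 1\<close> to \<open>cell (m + 1) n\<close>), those of class 3 the vertical ones (from \<open>cell m n + 1\<close> to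
  \<open>cell m (n + 1)\<close>), and the hexagon around \<open>cell m n + 2\<close> becomes a unit square.\<close>

definition cell :: "int \<Rightarrow> int \<Rightarrow> complex" where
  "cell m n = 1 + of_int m * (1 - \<omega>) + of_int n * (2 + \<omega>)"

lemma cell_coordinates: "cell m n = of_int (1 + m + 2 * n) + of_int (n - m) * \<omega>"
  by (simp add: cell_def algebra_simps)

lemma cell_in_class: "cell m n \<in> lattice_class 1"
proof -
  have "(1 + m + 2 * n + (n - m)) mod 3 = 1 mod 3" by simp
  then show ?thesis unfolding cell_coordinates lattice_class_def by blast
qed

lemma cell_inj: "cell m n = cell m' n' \<longleftrightarrow> m = m' \<and> n = n'"
proof
  assume "cell m n = cell m' n'"
  from omega_coordinates[OF this[unfolded cell_coordinates]]
  show "m = m' \<and> n = n'" by auto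
qed auto

lemma cell_exists:
  assumes "z \<in> lattice_class 1"
  obtains m n where "z = cell m n"
proof -
  obtain x y where xy: "z = of_int x + of_int y * \<omega>" "(x + y) mod 3 = 1 mod 3"
    using assms unfolding lattice_class_def by blast
  define n where "n = (x + y) div 3"
  have "x + y = 3 * n + 1" using xy(2) div_mult_mod_eq[of "x + y" 3] unfolding n_def by simp
  then have "1 + (n - y) + 2 * n = x" "n - (n - y) = y" by auto
  then have "z = cell (n - y) n"
    unfolding cell_coordinates xy(1) by simp
  then show ?thesis using that by blast
qed

lemma cell_shift:
  "cell (m + 1) n = cell m n + 1 - \<omega>" "cell m (n + 1) = cell m n + 2 + \<omega>"
  by (simp_all add: cell_def algebra_simps)

lemma lattice_class_1_induct:
  assumes "z \<in> lattice_class 1" "P 1"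
    and "\<And>z. z \<in> lattice_class 1 \<Longrightarrow> P z \<longleftrightarrow> P (z + 1 - \<omega>)"
    and "\<And>z. z \<in> lattice_class 1 \<Longrightarrow> P z \<longleftrightarrow> P (z + 2 + \<omega>)"
  shows "P z"
proof -
  have "P (cell m 0)" for m
  proof (induction m rule: int_bi_induct)
    case 1
    show ?case using assms(2) by (simp add: cell_def)
  next
    case (2 m)
    show ?case unfolding cell_shift using assms(3) cell_in_class by blast
  qed
  then have "P (cell m n)" for m n
  proof (induction n rule: int_bi_induct)
    case (2 n)
    show ?case unfolding cell_shift using assms(4) cell_in_class by blast
  qed
  then show ?thesis using cell_exists[OF assms(1)] by metis
qed

lemma cell_edges:
  "cell (m - 1) n + 1 = cell m n + \<omega>" "cell m (n - 1) + 1 = cell m n + \<omega>\<^sup>2"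
  using cell_shift(1)[of "m - 1" n] cell_shift(2)[of m "n - 1"] by (simp_all add: omega_sq)

text \<open>The map \<open>f j z\<close> transports along the edge of class \<open>j\<close> at \<open>z\<close>, in both directions, as it is an
  involution. The assumption \<open>closed\<close> compares the two ways from \<open>c - 1\<close> to \<open>c + 1\<close> around the hexagon
  with center \<open>c\<close>.\<close>

lemma hexagonal_integration:
  fixes f :: "nat \<Rightarrow> complex \<Rightarrow> 'a \<Rightarrow> 'a"
  assumes f: "\<And>j z x. j \<in> {1, 2, 3} \<Longrightarrow> z \<in> lattice_class 1 \<Longrightarrow> x \<in> X \<Longrightarrow> f j z x \<in> X"
      "\<And>j z x. j \<in> {1, 2, 3} \<Longrightarrow> z \<in> lattice_class 1 \<Longrightarrow> x \<in> X \<Longrightarrow> f j z (f j z x) = x"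
    and closed: "\<And>c x. c \<in> hex_F \<Longrightarrow> x \<in> X \<Longrightarrow>
      f 3 (c + 1) (f 1 (c + \<omega>\<^sup>2) (f 2 (c + \<omega>\<^sup>2) x)) = f 2 (c + 1) (f 1 (c + \<omega>) (f 3 (c + \<omega>) x))"
    and x0: "x0 \<in> X"
  obtains s where "s 1 = x0" "\<And>z. z \<in> hex_V \<Longrightarrow> s z \<in> X"
    "\<And>z j. z \<in> lattice_class 1 \<Longrightarrow> j \<in> {1, 2, 3} \<Longrightarrow> s (z + \<omega> ^ (j - 1)) = f j z (s z)"
proof -
  note c1 = cell_in_class
  define H where "H m n x = f 2 (cell (m + 1) n) (f 1 (cell m n) x)" for m n x
  define H' where "H' m n x = f 1 (cell m n) (f 2 (cell (m + 1) n) x)" for m n x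
  define U where "U m n x = f 3 (cell m (n + 1)) (f 1 (cell m n) x)" for m n x
  define U' where "U' m n x = f 1 (cell m n) (f 3 (cell m (n + 1)) x)" for m n x
  obtain P where P: "P 0 0 = x0" "\<And>m n. P m n \<in> X"
    "\<And>m n. P (m + 1) n = H m n (P m n)" "\<And>m n. P m (n + 1) = U m n (P m n)"
  proof (rule int_grid_exists[of X H H' U U' x0])
    show "U (m + 1) n (H m n x) = H m (n + 1) (U m n x)" if "x \<in> X" for m n x
    proof -
      have "cell m n + 2 \<in> hex_F"
        unfolding hex_F_eq using lattice_class_neighbours(1,4)[OF lattice_class_units(1)] c1
        by (metis add.assoc one_add_one)
      from closed[OF this f(1)[OF _ c1 that, of 1 m n]]
      show ?thesis
        unfolding H_def U_def cell_shift by (simp add: omega_sq algebra_simps)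
    qed
  qed (simp_all add: H_def H'_def U_def U'_def f c1 x0)
  have "\<exists>q. \<forall>z\<in>lattice_class 1. cell (fst (q z)) (snd (q z)) = z"
    by (rule exI[of _ "\<lambda>z. SOME p. cell (fst p) (snd p) = z"])
      (metis (mono_tags, lifting) cell_exists fst_conv snd_conv someI)
  then obtain q where q: "\<And>z. z \<in> lattice_class 1 \<Longrightarrow> cell (fst (q z)) (snd (q z)) = z" by blast
  have qc: "q (cell m n) = (m, n)" for m n
    using q[OF c1, of m n] by (simp add: cell_inj prod_eq_iff)
  define sA where "sA z = P (fst (q z)) (snd (q z))" for z
  have sA: "sA (cell m n) = P m n" for m n by (simp add: sA_def qc)
  define s where "s z = (if z \<in> lattice_class 1 then sA z else f 1 (z - 1) (sA (z - 1)))" for z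
  have s1: "s (cell m n) = P m n" for m n by (simp add: s_def c1 sA)
  have s2: "s (cell m n + 1) = f 1 (cell m n) (P m n)" for m n
  proof -
    have "cell m n + 1 \<in> lattice_class 2"
      by (rule lattice_class_neighbours(1)[OF lattice_class_units(1) c1])
    then have "cell m n + 1 \<notin> lattice_class 1" using lattice_class_disjoint[of _ 1 2] by auto
    then show ?thesis by (simp add: s_def sA)
  qed
  show ?thesis
  proof
    have "cell 0 0 = 1" by (simp add: cell_def)
    then show "s 1 = x0" using s1[of 0 0] P(1) by simp
    show "s z \<in> X" if V: "z \<in> hex_V" for z
    proof (cases "z \<in> lattice_class 1")
      case True
      then show ?thesis using cell_exists s1 P(2) by metis
    next
      case False
      then have "z \<in> lattice_class 2" using V hex_V_eq by blast
      then have "z - 1 \<in> lattice_class 1"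
        by (rule lattice_class_neighbours(3)[OF lattice_class_units(1)])
      then obtain m n where "z - 1 = cell m n" by (rule cell_exists)
      then have "z = cell m n + 1" by (metis diff_add_cancel)
      then show ?thesis using s2 P(2) f(1) c1 by simp
    qed
    show "s (z + \<omega> ^ (j - 1)) = f j z (s z)" if z: "z \<in> lattice_class 1" and j: "j \<in> {1, 2, 3}" for z j
    proof -
      obtain m n where mn: "z = cell m n" using cell_exists[OF z] .
      have e2: "s (cell m n + \<omega>) = f 2 (cell m n) (P m n)"
        unfolding cell_edges(1)[symmetric] s2 using P(3)[of "m - 1" n] f P(2) c1
        by (simp add: H_def)
      have e3: "s (cell m n + \<omega>\<^sup>2) = f 3 (cell m n) (P m n)"
        unfolding cell_edges(2)[symmetric] s2 using P(4)[of m "n - 1"] f P(2) c1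
        by (simp add: U_def)
      from j show ?thesis
        unfolding mn s1 using s2 e2 e3 by auto
    qed
  qed
qed

lemma hexagonal_section_unique:
  fixes f :: "nat \<Rightarrow> complex \<Rightarrow> 'a \<Rightarrow> 'a"
  assumes f: "\<And>j z x. j \<in> {1, 2, 3} \<Longrightarrow> z \<in> lattice_class 1 \<Longrightarrow> x \<in> X \<Longrightarrow> f j z (f j z x) = x"
    and s: "\<And>z. z \<in> hex_V \<Longrightarrow> s z \<in> X"
      "\<And>z j. z \<in> lattice_class 1 \<Longrightarrow> j \<in> {1, 2, 3} \<Longrightarrow> s (z + \<omega> ^ (j - 1)) = f j z (s z)"
    and s': "\<And>z. z \<in> hex_V \<Longrightarrow> s' z \<in> X"
      "\<And>z j. z \<in> lattice_class 1 \<Longrightarrow> j \<in> {1, 2, 3} \<Longrightarrow> s' (z + \<omega> ^ (j - 1)) = f j z (s' z)"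
    and init: "s 1 = s' 1" and z: "z \<in> hex_V"
  shows "s z = s' z"
proof -
  have step: "s z = s' z \<longleftrightarrow> s (z + \<omega> ^ (j - 1)) = s' (z + \<omega> ^ (j - 1))"
    if "z \<in> lattice_class 1" "j \<in> {1, 2, 3}" for z j
  proof -
    have "z \<in> hex_V" using that hex_V_eq by blast
    then show ?thesis using s s' f that by metis
  qed
  note n = lattice_class_neighbours[OF lattice_class_units(1)]
    lattice_class_neighbours[OF lattice_class_units(2)]
    lattice_class_neighbours[OF lattice_class_units(3)]
  have A: "s z = s' z" if "z \<in> lattice_class 1" for z
  proof (rule lattice_class_1_induct[OF that, of "\<lambda>z. s z = s' z"])
    fix z assume z: "z \<in> lattice_class 1"
    have eq: "z + 1 - \<omega> + \<omega> = z + 1" "z + 2 + \<omega> + \<omega>\<^sup>2 = z + 1" by (simp_all add: omega_sq)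
    have "z + 1 - \<omega> \<in> lattice_class 1" using n(1)[OF z] n(9) by blast
    moreover have "z + 1 - \<omega>\<^sup>2 \<in> lattice_class 1" by (rule n(15)[OF n(1)[OF z]])
    then have "z + 2 + \<omega> \<in> lattice_class 1" unfolding omega_sq by (simp add: algebra_simps)
    ultimately show "s z = s' z \<longleftrightarrow> s (z + 1 - \<omega>) = s' (z + 1 - \<omega>)"
      "s z = s' z \<longleftrightarrow> s (z + 2 + \<omega>) = s' (z + 2 + \<omega>)"
      using step[of z 1] step[of "z + 1 - \<omega>" 2] step[of "z + 2 + \<omega>" 3] z eq by simp_all
  qed (rule init)
  show ?thesis
  proof (cases "z \<in> lattice_class 1")
    case False
    then have "z - 1 \<in> lattice_class 1" using z hex_V_eq n(3) by blast
    then show ?thesis using A step[of "z - 1" 1] by simp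
  qed (rule A)
qed

section \<open>Reconstruction from the edge cross-ratios\<close>

lemma solves_hex_values:
  assumes T: "solves_hex T" and c: "c \<in> hex_F"
  defines "t \<equiv> \<lambda>i. affine (T (hex_edge c i))"
  shows "T (hex_edge c i) = Fin (t i)" "t i \<noteq> 1"
    "hex_relation (t (i + 1)) (t (i + 2)) (t (i + 3)) (t (i + 4)) (t (i + 5)) (t (i + 6))"
proof -
  have *: "T (hex_edge c (i + 1)) = Fin (t (i + 1)) \<and>
      hex_relation (t (i + 1)) (t (i + 2)) (t (i + 3)) (t (i + 4)) (t (i + 5)) (t (i + 6))" for i
    using T c unfolding solves_hex_def t_def by (metis csphere.sel)
  have "hex_relation (t (i - 1)) (t i) (t (i + 1)) (t (i + 2)) (t (i + 3)) (t (i + 4))"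
    using *[of "i - 2"] by (simp add: algebra_simps)
  then show "t i \<noteq> 1" by (auto simp: hex_relation_def)
  show "T (hex_edge c i) = Fin (t i)" using *[of "i - 1"] by simp
  show "hex_relation (t (i + 1)) (t (i + 2)) (t (i + 3)) (t (i + 4)) (t (i + 5)) (t (i + 6))"
    using * by blast
qed

lemma hex_edge_6: "hex_edge c (i + 6) = hex_edge c i"
  unfolding hex_edge_def using hex_vertex_6[of c i] hex_vertex_6[of c "i + 1"]
  by (simp add: ac_simps)

text \<open>For a vertex \<open>z\<close> of lattice class \<open>1\<close> and a cube root of unity \<open>u\<close>, the edge from \<open>z\<close> to
  \<open>z + \<omega> * u\<close> lies between the hexagons with centers \<open>z - u\<close> and \<open>z - \<omega>\<^sup>2 * u\<close>.\<close>

lemma edge_hexagons: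
  assumes u: "\<epsilon> powi i = u" and v: "\<epsilon> powi i' = - u"
  shows "edge_cross_ratio w (z - u) i =
      cross_ratio (w z) (w (z + \<omega> * u)) (w (z + \<omega> * u - u)) (w (z + \<omega>\<^sup>2 * u))"
    and "hex_edge (z - u) i = {z, z + \<omega> * u}"
    and "edge_cross_ratio w (z - \<omega>\<^sup>2 * u) i' =
      cross_ratio (w z) (w (z + \<omega> * u)) (w (z + \<omega> * u - \<omega>\<^sup>2 * u)) (w (z + u))"
    and "hex_edge (z - \<omega>\<^sup>2 * u) i' = {z, z + \<omega> * u}"
proof -
  have 1: "hex_vertex (z - u) i = z" "hex_vertex (z - u) (i + 1) = z + \<omega> * u"
    "hex_vertex (z - u) (i + 2) = z + \<omega> * u - u" "hex_vertex (z - u) (i - 1) = z + \<omega>\<^sup>2 * u"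
    unfolding hex_vertex_def eps_powi_add u omega_sq by (simp_all add: algebra_simps)
  have 2: "hex_vertex (z - \<omega>\<^sup>2 * u) i' = z + \<omega> * u" "hex_vertex (z - \<omega>\<^sup>2 * u) (i' + 1) = z"
    "hex_vertex (z - \<omega>\<^sup>2 * u) (i' + 2) = z + u"
    "hex_vertex (z - \<omega>\<^sup>2 * u) (i' - 1) = z + \<omega> * u - \<omega>\<^sup>2 * u"
    unfolding hex_vertex_def eps_powi_add v omega_sq by (simp_all add: algebra_simps)
  show "edge_cross_ratio w (z - u) i =
      cross_ratio (w z) (w (z + \<omega> * u)) (w (z + \<omega> * u - u)) (w (z + \<omega>\<^sup>2 * u))"
    "hex_edge (z - u) i = {z, z + \<omega> * u}"
    "hex_edge (z - \<omega>\<^sup>2 * u) i' = {z, z + \<omega> * u}"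
    unfolding edge_cross_ratio_def hex_edge_def 1 2 by auto
  show "edge_cross_ratio w (z - \<omega>\<^sup>2 * u) i' =
      cross_ratio (w z) (w (z + \<omega> * u)) (w (z + \<omega> * u - \<omega>\<^sup>2 * u)) (w (z + u))"
    unfolding edge_cross_ratio_def 2 by (rule cross_ratio_reverse)
qed

definition cube_roots :: "complex set" where
  "cube_roots = {1, \<omega>, \<omega>\<^sup>2}"

lemma cube_roots_eps:
  "u \<in> cube_roots \<Longrightarrow> \<exists>i. \<epsilon> powi i = u" "u \<in> cube_roots \<Longrightarrow> \<exists>i. \<epsilon> powi i = - u"
  "\<epsilon> powi i \<in> cube_roots \<or> - (\<epsilon> powi i) \<in> cube_roots"
proof -
  show 1: "u \<in> cube_roots \<Longrightarrow> \<exists>i. \<epsilon> powi i = u" for u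
    using eps_powi_values unfolding cube_roots_def by blast
  show "\<exists>i. \<epsilon> powi i = - u" if "u \<in> cube_roots"
    using 1[OF that] eps_powi_add(3) by metis
  obtain j where "j \<in> {1, 2, 3 :: nat}" "\<epsilon> powi i = \<omega> ^ (j - 1) \<or> \<epsilon> powi i = - (\<omega> ^ (j - 1))"
    by (rule eps_powi_direction)
  then show "\<epsilon> powi i \<in> cube_roots \<or> - (\<epsilon> powi i) \<in> cube_roots"
    unfolding cube_roots_def by auto
qed

lemma cube_roots_class: "u \<in> cube_roots \<Longrightarrow> u \<in> lattice_class 1"
  using lattice_class_units unfolding cube_roots_def by auto

lemma cube_roots_mult: "u \<in> cube_roots \<Longrightarrow> \<omega>\<^sup>2 * u \<in> cube_roots"
  unfolding cube_roots_def by (auto simp: omega_cubed power2_eq_square[symmetric])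

text \<open>Listing the edges by their ends in lattice class \<open>1\<close> instead of by the hexagons and the
  positions in them.\<close>

lemma has_edge_cross_ratios_iff:
  "has_edge_cross_ratios w T \<longleftrightarrow> (\<forall>z\<in>lattice_class 1. \<forall>u\<in>cube_roots.
     cross_ratio (w z) (w (z + \<omega> * u)) (w (z + \<omega> * u - u)) (w (z + \<omega>\<^sup>2 * u)) = T {z, z + \<omega> * u} \<and>
     cross_ratio (w z) (w (z + \<omega> * u)) (w (z + \<omega> * u - \<omega>\<^sup>2 * u)) (w (z + u)) = T {z, z + \<omega> * u})"
  (is "?L \<longleftrightarrow> ?R")
proof
  assume L: ?L
  show ?R
  proof (intro ballI)
    fix z u assume z: "z \<in> lattice_class 1" and u: "u \<in> cube_roots"
    obtain i i' where i: "\<epsilon> powi i = u" "\<epsilon> powi i' = - u" using cube_roots_eps u by blast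
    have "z - u \<in> hex_F" "z - \<omega>\<^sup>2 * u \<in> hex_F"
      unfolding hex_F_eq using lattice_class_neighbours(2) z u cube_roots_class cube_roots_mult
      by blast+
    then show "cross_ratio (w z) (w (z + \<omega> * u)) (w (z + \<omega> * u - u)) (w (z + \<omega>\<^sup>2 * u))
          = T {z, z + \<omega> * u} \<and>
        cross_ratio (w z) (w (z + \<omega> * u)) (w (z + \<omega> * u - \<omega>\<^sup>2 * u)) (w (z + u))
          = T {z, z + \<omega> * u}"
      using L edge_hexagons[OF i] unfolding has_edge_cross_ratios_def by metis
  qed
next
  assume R: ?R
  show ?L
    unfolding has_edge_cross_ratios_def
  proof (intro ballI allI)
    fix c i assume c: "c \<in> hex_F"
    consider "\<epsilon> powi i \<in> cube_roots" | "- (\<epsilon> powi i) \<in> cube_roots" using cube_roots_eps(3) by blast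
    then show "edge_cross_ratio w c i = T (hex_edge c i)"
    proof cases
      case 1
      define u where "u = \<epsilon> powi i"
      have z: "c + u \<in> lattice_class 1"
        using 1 c cube_roots_class lattice_class_neighbours(5) unfolding hex_F_eq u_def by blast
      obtain i' where "\<epsilon> powi i' = - u" using cube_roots_eps(2) 1 u_def by blast
      note e = edge_hexagons[OF u_def[symmetric] this]
      show ?thesis
        using R[rule_format, OF z, of u] 1 e(1)[of w "c + u"] e(2)[of "c + u"] u_def by simp
    next
      case 2
      define u where "u = - (\<epsilon> powi i)"
      have z: "c + \<omega>\<^sup>2 * u \<in> lattice_class 1"
        using 2 c cube_roots_class cube_roots_mult lattice_class_neighbours(5)
        unfolding hex_F_eq u_def by blast
      obtain i' where i': "\<epsilon> powi i' = u" using cube_roots_eps(1) 2 u_def by blast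
      have u: "u \<in> cube_roots" "\<epsilon> powi i = - u" using 2 u_def by simp_all
      have "edge_cross_ratio w c i = T {c + \<omega>\<^sup>2 * u, c + \<omega>\<^sup>2 * u + \<omega> * u}"
        using R[rule_format, OF z u(1)] edge_hexagons(3)[OF i' u(2), of w "c + \<omega>\<^sup>2 * u"] by simp
      moreover have "hex_edge c i = {c + \<omega>\<^sup>2 * u, c + \<omega>\<^sup>2 * u + \<omega> * u}"
        using edge_hexagons(4)[OF i' u(2), of "c + \<omega>\<^sup>2 * u"] by simp
      ultimately show ?thesis by simp
    qed
  qed
qed

definition transport :: "(complex set \<Rightarrow> csphere) \<Rightarrow> nat \<Rightarrow> complex \<Rightarrow> star \<Rightarrow> star" where
  "transport T j z = edge_step j (T {z, z + \<omega> ^ (j - 1)})"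

text \<open>Two of the four points of the star at the other end are the ends of the edge, and the
  equations for the remaining two are the cross-ratio conditions in the two hexagons.\<close>

lemma has_edge_cross_ratios_iff_transport:
  assumes w: "has_constant_S w S" and S: "S \<noteq> 0" "S \<noteq> 1"
  shows "has_edge_cross_ratios w T \<longleftrightarrow> (\<forall>z\<in>lattice_class 1. \<forall>j\<in>{1, 2, 3}.
     star_at w (z + \<omega> ^ (j - 1)) = transport T j z (star_at w z))"
proof -
  have "(\<forall>j\<in>{1, 2, 3}. star_at w (z + \<omega> ^ (j - 1)) = transport T j z (star_at w z)) \<longleftrightarrow>
    (\<forall>u\<in>cube_roots.
     cross_ratio (w z) (w (z + \<omega> * u)) (w (z + \<omega> * u - u)) (w (z + \<omega>\<^sup>2 * u)) = T {z, z + \<omega> * u} \<and>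
     cross_ratio (w z) (w (z + \<omega> * u)) (w (z + \<omega> * u - \<omega>\<^sup>2 * u)) (w (z + u)) = T {z, z + \<omega> * u})"
    if z: "z \<in> lattice_class 1" for z
  proof -
    have "star_at w z \<in> stars S" using w z has_constant_S_iff hex_V_eq by blast
    then have "cross_ratio (w (z + 1)) (w (z + \<omega>)) (w z) (w (z + \<omega>\<^sup>2)) = Fin S"
      unfolding star_at_simps(1)[OF z] in_stars .
    note d = cross_ratio_all_distinct[OF this S]
    have z2: "z + 1 \<in> lattice_class 2" "z + \<omega> \<in> lattice_class 2" "z + \<omega>\<^sup>2 \<in> lattice_class 2"
      using lattice_class_neighbours(1)[OF _ z] lattice_class_units by blast+
    have f: "x = fourth (w z) (w b) (w a) t \<longleftrightarrow> cross_ratio (w z) (w b) x (w a) = t"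
      if "w z \<noteq> w b" "w z \<noteq> w a" "w b \<noteq> w a" for x a b t
      using fourth_eq_iff[OF that] by metis
    show ?thesis
      using d unfolding transport_def cube_roots_def
      by (auto simp: star_at_simps(1)[OF z] star_at_simps(2)[OF z2(1)] star_at_simps(2)[OF z2(2)]
          star_at_simps(2)[OF z2(3)] f omega_cubed power2_eq_square[symmetric])
  qed
  then show ?thesis unfolding has_edge_cross_ratios_iff by blast
qed

lemma edge_hexagon_exists:
  assumes "z \<in> lattice_class 1" "j \<in> {1, 2, 3 :: nat}"
  obtains c i where "c \<in> hex_F" "{z, z + \<omega> ^ (j - 1)} = hex_edge c i"
proof -
  have "\<exists>u\<in>cube_roots. \<omega> * u = \<omega> ^ (j - 1)"
    using assms(2) omega_cubed unfolding cube_roots_def by (auto simp: power2_eq_square[symmetric])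
  then obtain u where u: "u \<in> cube_roots" "\<omega> * u = \<omega> ^ (j - 1)" by blast
  obtain i i' where i: "\<epsilon> powi i = u" "\<epsilon> powi i' = - u" using cube_roots_eps u by blast
  have "z - u \<in> hex_F"
    unfolding hex_F_eq using lattice_class_neighbours(2) assms(1) u(1) cube_roots_class by blast
  then show ?thesis using that edge_hexagons(2)[OF i, of z] u by metis
qed

lemma transport_properties:
  assumes T: "solves_hex T" and S: "S \<noteq> 0" "S \<noteq> 1"
    and z: "z \<in> lattice_class 1" "j \<in> {1, 2, 3 :: nat}" and x: "x \<in> stars S"
  shows "transport T j z x \<in> stars S" "transport T j z (transport T j z x) = x"
proof -
  obtain c i where c: "c \<in> hex_F" "{z, z + \<omega> ^ (j - 1)} = hex_edge c i"
    using edge_hexagon_exists[OF z] .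
  obtain t where t: "T (hex_edge c i) = Fin t" "t \<noteq> 1"
    using solves_hex_values(1,2)[OF T c(1), of i] by blast
  show "transport T j z x \<in> stars S" "transport T j z (transport T j z x) = x"
    unfolding transport_def c(2) t(1)
    using edge_step_in_stars[OF S x t(2)] edge_step_involution[OF S x t(2)] by auto
qed

lemma transport_closes:
  assumes T: "solves_hex T" and S: "S \<noteq> 0" "S \<noteq> 1" and c: "c \<in> hex_F" and x: "x \<in> stars S"
  shows "transport T 3 (c + 1) (transport T 1 (c + \<omega>\<^sup>2) (transport T 2 (c + \<omega>\<^sup>2) x)) =
    transport T 2 (c + 1) (transport T 1 (c + \<omega>) (transport T 3 (c + \<omega>) x))"
proof -
  define t where "t i = affine (T (hex_edge c i))" for i
  note v = solves_hex_values[OF T c, folded t_def]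
  have v0: "hex_vertex c 0 = c + 1" "hex_vertex c 1 = c + (1 + \<omega>)" "hex_vertex c 2 = c + \<omega>"
    "hex_vertex c 3 = c - 1" "hex_vertex c 4 = c + \<omega>\<^sup>2" "hex_vertex c 5 = c - \<omega>"
    unfolding hex_vertex_def eps_powi_values omega_sq by simp_all
  have e: "hex_edge c 0 = {c + 1, c + 1 + \<omega>}" "hex_edge c 1 = {c + \<omega>, c + \<omega> + 1}"
    "hex_edge c 2 = {c + \<omega>, c + \<omega> + \<omega>\<^sup>2}" "hex_edge c 3 = {c + \<omega>\<^sup>2, c + \<omega>\<^sup>2 + \<omega>}"
    "hex_edge c 4 = {c + \<omega>\<^sup>2, c + \<omega>\<^sup>2 + 1}" "hex_edge c 5 = {c + 1, c + 1 + \<omega>\<^sup>2}"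
    using hex_vertex_6[of c 0] by (auto simp: hex_edge_def v0 omega_sq algebra_simps)
  have per: "t 6 = t 0" "t 7 = t 1" "t 8 = t 2"
    using hex_edge_6[of c 0] hex_edge_6[of c 1] hex_edge_6[of c 2] unfolding t_def by simp_all
  have "edge_step 3 (Fin (t 5)) (edge_step 1 (Fin (t 4)) (edge_step 2 (Fin (t 3)) x)) =
        edge_step 2 (Fin (t 0)) (edge_step 1 (Fin (t 1)) (edge_step 3 (Fin (t 2)) x))"
    by (rule edge_steps_close[OF S x]) (use v(2) v(3)[of 2] per in simp_all)
  then show ?thesis
    unfolding transport_def v(1)[symmetric] e by simp
qed

lemma standard_star: "(Infty, Fin 0, Fin S, Fin 1) \<in> stars S"
  by (simp add: in_stars cross_ratio_def proj_quot_def)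

lemma moebius_preserves:
  assumes M: "is_moebius M" and w': "\<And>z. z \<in> hex_V \<Longrightarrow> w' z = M (w z)"
  shows "has_constant_S w S \<Longrightarrow> has_constant_S w' S"
    "has_edge_cross_ratios w T \<Longrightarrow> has_edge_cross_ratios w' T"
proof -
  show "has_constant_S w' S" if "has_constant_S w S"
    using that w' cross_ratio_moebius[OF M] unfolding has_constant_S_def hex_Ecl_iff by simp
  show "has_edge_cross_ratios w' T" if "has_edge_cross_ratios w T"
    using that w' hex_vertex_in_V cross_ratio_moebius[OF M]
    unfolding has_edge_cross_ratios_def edge_cross_ratio_def by simp
qed

text \<open>The transport provides a parallel field \<open>s\<close> of stars. Its midpoints form a map, and transport
  along an edge exchanges midpoint and neighbour, so the stars of this map are the given ones.\<close>

lemma constant_S_map_exists: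
  assumes T: "solves_hex T" and S: "S \<noteq> 0" "S \<noteq> 1"
  obtains w where "has_edge_cross_ratios w T" "has_constant_S w S"
proof -
  obtain s where s: "\<And>z. z \<in> hex_V \<Longrightarrow> s z \<in> stars S"
    "\<And>z j. z \<in> lattice_class 1 \<Longrightarrow> j \<in> {1, 2, 3} \<Longrightarrow> s (z + \<omega> ^ (j - 1)) = transport T j z (s z)"
    by (rule hexagonal_integration[of "stars S" "transport T", OF _ _ _ standard_star])
      ((rule transport_properties[OF T S] transport_closes[OF T S] | assumption)+, blast)
  define w where "w z = fst (s z)" for z
  have star: "star_at w z = s z" if V: "z \<in> hex_V" for z
  proof -
    obtain p a1 a2 a3 where sz: "s z = (p, a1, a2, a3)" by (metis prod_cases4)
    have fst_tr: "fst (transport T 1 y (s z)) = a1" "fst (transport T 2 y (s z)) = a2"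
      "fst (transport T 3 y (s z)) = a3" for y
      by (simp_all add: transport_def sz)
    consider "z \<in> lattice_class 1" | "z \<in> lattice_class 2" using V hex_V_eq by blast
    then show ?thesis
    proof cases
      case 1
      have "w (z + \<omega> ^ (j - 1)) = fst (transport T j z (s z))" if "j \<in> {1, 2, 3}" for j
        using s(2)[OF 1 that] by (simp add: w_def)
      from this[of 1] this[of 2] this[of 3] show ?thesis
        unfolding star_at_simps(1)[OF 1] fst_tr by (simp add: w_def sz)
    next
      case 2
      have "w (z - \<omega> ^ (j - 1)) = fst (transport T j (z - \<omega> ^ (j - 1)) (s z))"
        if j: "j \<in> {1, 2, 3}" for j
      proof -
        have z1: "z - \<omega> ^ (j - 1) \<in> lattice_class 1"
          by (rule lattice_class_neighbours(3)[OF omega_power_class[OF j] 2])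
        then have "z - \<omega> ^ (j - 1) \<in> hex_V" using hex_V_eq by blast
        then show ?thesis
          using s(2)[OF z1 j] transport_properties(2)[OF T S z1 j s(1)] by (simp add: w_def)
      qed
      from this[of 1] this[of 2] this[of 3] show ?thesis
        unfolding star_at_simps(2)[OF 2] fst_tr by (simp add: w_def sz)
    qed
  qed
  have w: "has_constant_S w S" unfolding has_constant_S_iff using star s(1) by simp
  moreover have "has_edge_cross_ratios w T"
    unfolding has_edge_cross_ratios_iff_transport[OF w S]
  proof (intro ballI)
    fix z j assume z: "z \<in> lattice_class 1" and j: "j \<in> {1, 2, 3 :: nat}"
    have "z \<in> hex_V" "z + \<omega> ^ (j - 1) \<in> hex_V"
      using z lattice_class_neighbours(1)[OF omega_power_class[OF j] z] hex_V_eq by blast+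
    then show "star_at w (z + \<omega> ^ (j - 1)) = transport T j z (star_at w z)"
      using s(2)[OF z j] star by simp
  qed
  ultimately show ?thesis using that by blast
qed

text \<open>A Moebius transformation matches three points of the stars of the two maps at the vertex \<open>1\<close>; the
  fourth points match because both have the cross-ratio \<open>S\<close>. Composing with it yields two
  parallel fields with the same initial star.\<close>

lemma constant_S_map_unique:
  assumes T: "solves_hex T" and S: "S \<noteq> 0" "S \<noteq> 1"
    and w: "has_edge_cross_ratios w T" "has_constant_S w S"
    and w': "has_edge_cross_ratios w' T" "has_constant_S w' S"
  obtains M where "is_moebius M" "\<And>z. z \<in> hex_V \<Longrightarrow> w' z = M (w z)"
proof -
  have V: "1 \<in> hex_V" using lattice_class_units hex_V_eq by blast
  obtain p a1 a2 a3 where st: "star_at w 1 = (p, a1, a2, a3)" by (metis prod_cases4)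
  obtain p' a1' a2' a3' where st': "star_at w' 1 = (p', a1', a2', a3')" by (metis prod_cases4)
  have cr: "cross_ratio a1 a2 p a3 = Fin S"
    using w(2) V st has_constant_S_iff in_stars by metis
  have cr': "cross_ratio a1' a2' p' a3' = Fin S"
    using w'(2) V st' has_constant_S_iff in_stars by metis
  note d = cross_ratio_all_distinct[OF cr S] and d' = cross_ratio_all_distinct[OF cr' S]
  obtain M where M: "is_moebius M" "M p = p'" "M a1 = a1'" "M a2 = a2'"
    using moebius_three_points[of p a1 a2 p' a1' a2'] d d' by metis
  have "cross_ratio a2' a1' (M a3) p' = Fin S" "cross_ratio a2' a1' a3' p' = Fin S"
    using cr cr' cross_ratio_moebius[OF M(1)] M cross_ratio_reverse by metis+
  then have a3: "M a3 = a3'" using cross_ratio_bij[of a2' a1' p'] d' by metis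
  define v where "v z = M (w z)" for z
  have v: "has_edge_cross_ratios v T" "has_constant_S v S"
    using moebius_preserves[OF M(1), of v w] w v_def by auto
  have "star_at v 1 = star_at w' 1"
    using st st' M a3 unfolding star_at_simps(1)[OF lattice_class_units(1)] v_def by auto
  then have "star_at w' z = star_at v z" if "z \<in> hex_V" for z
  proof (intro hexagonal_section_unique[where s = "star_at w'" and s' = "star_at v", OF _ _ _ _ _ _ that])
    show "transport T j z (transport T j z x) = x"
      if "j \<in> {1, 2, 3}" "z \<in> lattice_class 1" "x \<in> stars S" for j z x
      using transport_properties(2)[OF T S] that by blast
    show "star_at w' z \<in> stars S" "star_at v z \<in> stars S" if "z \<in> hex_V" for z
      using w'(2) v(2) that unfolding has_constant_S_iff by blast+
    show "star_at w' (z + \<omega> ^ (j - 1)) = transport T j z (star_at w' z)"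
      "star_at v (z + \<omega> ^ (j - 1)) = transport T j z (star_at v z)"
      if "z \<in> lattice_class 1" "j \<in> {1, 2, 3}" for z j
      using w'(1) v(1) that unfolding has_edge_cross_ratios_iff_transport[OF v(2) S]
        has_edge_cross_ratios_iff_transport[OF w'(2) S] by blast+
    show "star_at w' 1 = star_at v 1" using \<open>star_at v 1 = star_at w' 1\<close> by simp
  qed
  moreover have "fst (star_at u z) = u z" for u z by (simp add: star_at_def)
  ultimately have "w' z = M (w z)" if "z \<in> hex_V" for z using that v_def by metis
  then show ?thesis using that M(1) by blast
qed

section \<open>Circles through the hexagons\<close>

text \<open>The cross-ratios \<open>t6\<close> and \<open>t1\<close> place \<open>y5\<close> and \<open>y3\<close> beyond \<open>1\<close>. By \<open>t3\<close>, the point \<open>y4\<close> is an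
  average of \<open>y3\<close> and \<open>y5\<close> with positive weights, and \<open>t2\<close> excludes the order
  \<open>y5 < y4 < y3\<close>.\<close>

lemma six_points_in_order:
  assumes T: "cross_ratio Infty (Fin 0) (Fin 1) y5 = Fin (of_real t6)" "t6 < 0"
    "cross_ratio (Fin 0) (Fin 1) y3 Infty = Fin (of_real t1)" "t1 < 0"
    "cross_ratio (Fin 1) y3 y4 (Fin 0) = Fin (of_real t2)" "t2 < 0"
    "cross_ratio y3 y4 y5 (Fin 1) = Fin (of_real t3)" "t3 < 0"
    and ne: "y3 \<noteq> y4"
  obtains a b c :: real where "y3 = Fin (of_real a)" "y4 = Fin (of_real b)" "y5 = Fin (of_real c)"
    "1 < a" "a < b" "b < c"
proof -
  obtain z5 where z5: "y5 = Fin z5" using T(1) by (cases y5) (auto simp: cross_ratio_eq_Fin_iff)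
  define c where "c = 1 - t6"
  have c: "y5 = Fin (of_real c)" "c > 1"
    using T(1,2) unfolding z5 c_def by (auto simp: cross_ratio_eq_Fin_iff algebra_simps)
  obtain z3 where z3: "y3 = Fin z3"
    using T(3,4) by (cases y3) (auto simp: cross_ratio_eq_Fin_iff)
  define a where "a = 1 - 1 / t1"
  have ta: "t1 * a = t1 - 1" using T(4) by (simp add: a_def right_diff_distrib)
  have "of_real t1 * z3 = of_real (t1 * a)"
    using T(3,4) unfolding z3 ta by (auto simp: cross_ratio_eq_Fin_iff algebra_simps)
  then have a: "y3 = Fin (of_real a)" "a > 1"
    using T(4) unfolding z3 by (simp_all, simp add: a_def)
  \<comment> \<open>The equation for \<open>t3\<close> reads \<open>k * y4 = (c - 1) * a + (- t3 * (a - 1)) * c\<close>; here \<open>k\<close> is the sum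
    of the weights.\<close>
  define k where "k = (c - 1) - t3 * (a - 1)"
  have k: "k > 0"
    unfolding k_def using c(2) a(2) T(8) by (smt (verit) mult_neg_pos)
  obtain z4 where z4: "y4 = Fin z4"
  proof (cases y4)
    case Infty
    then have "of_real (c - 1) = (of_real (t3 * (a - 1)) :: complex)"
      using T(7) unfolding a(1) c(1) by (simp add: cross_ratio_eq_Fin_iff algebra_simps)
    then have "k = 0" unfolding k_def of_real_eq_iff by simp
    with k show ?thesis by simp
  qed (use that in auto)
  define b where "b = (a * (c - 1) - t3 * (a - 1) * c) / k"
  have kb: "k * b = a * (c - 1) - t3 * (a - 1) * c" using k by (simp add: b_def)
  have "of_real k * z4 = of_real (k * b)"
    using T(7) unfolding kb unfolding k_def z4 a(1) c(1)
    by (simp add: cross_ratio_eq_Fin_iff algebra_simps)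
  then have b: "y4 = Fin (of_real b)"
    using k unfolding z4 by simp
  have "of_real ((a - 1) * (0 - b)) = (of_real (t2 * (b - a)) :: complex)"
    using T(5) unfolding a(1) b by (simp add: cross_ratio_eq_Fin_iff algebra_simps)
  then have b2: "(a - 1) * b = - t2 * (b - a)" unfolding of_real_eq_iff by simp
  have "k * (b - a) = - t3 * (a - 1) * (c - a)" "k * (c - b) = (c - 1) * (c - a)"
    unfolding right_diff_distrib[of k] unfolding kb unfolding k_def by (simp_all add: algebra_simps)
  have "b > 0"
  proof -
    have "a * (c - 1) > 0" "- t3 * ((a - 1) * c) > 0"
      using a(2) c(2) T(8) by (simp_all add: mult_neg_pos)
    then have "k * b > 0" unfolding kb by (simp add: algebra_simps)
    then show ?thesis using k by (simp add: zero_less_mult_iff)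
  qed
  then have "- t2 * (b - a) > 0" using a(2) unfolding b2[symmetric] by simp
  then have ab: "a < b" using T(6) by (simp add: zero_less_mult_iff mult_less_0_iff)
  have "- t3 * (a - 1) * (c - a) > 0"
    using \<open>k * (b - a) = - t3 * (a - 1) * (c - a)\<close> k ab by (metis diff_gt_0_iff_gt mult_pos_pos)
  moreover have "- t3 * (a - 1) > 0" using a(2) T(8) by (intro mult_pos_pos) auto
  ultimately have "0 < c - a" by (rule zero_less_mult_pos)
  then have "a < c" by simp
  then have "k * (c - b) > 0" using c(2) \<open>k * (c - b) = (c - 1) * (c - a)\<close> by simp
  then have "b < c" using k by (simp add: zero_less_mult_iff)
  show ?thesis by (rule that[OF a(1) b c(1) a(2) ab \<open>b < c\<close>])
qed

text \<open>Takes the unit circle to the real line, with \<open>cis \<theta>\<close> going to \<open>- cot (\<theta> / 2)\<close>. This increases from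
  \<open>-\<infinity>\<close> to \<open>\<infinity>\<close> on \<open>(0, 2 \<pi>)\<close>, so increasing real numbers come from increasing angles.\<close>

definition cayley :: "csphere \<Rightarrow> csphere" where
  "cayley = moebius_map (- \<i>) (- \<i>) 1 (- 1)"

lemma is_moebius_cayley: "is_moebius cayley"
  unfolding is_moebius_def cayley_def
  by (rule exI[of _ "- \<i>"], rule exI[of _ "- \<i>"], rule exI[of _ 1], rule exI[of _ "- 1"]) simp

lemma cayley_1: "cayley (Fin 1) = Infty"
  by (simp add: cayley_def proj_quot_def)

lemma cayley_arctan: "cayley (Fin (cis (2 * arctan x + pi))) = Fin (of_real x)"
proof -
  have nz: "1 - \<i> * of_real x \<noteq> 0" by (simp add: complex_eq_iff)
  have s: "(sqrt (1 + x\<^sup>2))\<^sup>2 = 1 + x\<^sup>2" by (simp add: add_nonneg_nonneg)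
  have "cis (2 * arctan x + pi) = - (cis (arctan x) * cis (arctan x))"
    by (simp add: cis_mult complex_eq_iff)
  also have "cis (arctan x) = (1 + \<i> * of_real x) / of_real (sqrt (1 + x\<^sup>2))"
    by (simp add: complex_eq_iff cos_arctan sin_arctan)
  also have "(1 + \<i> * of_real x) / of_real (sqrt (1 + x\<^sup>2)) *
      ((1 + \<i> * of_real x) / of_real (sqrt (1 + x\<^sup>2)))
      = (1 + \<i> * of_real x)\<^sup>2 / of_real (1 + x\<^sup>2)"
    by (simp only: power2_eq_square[symmetric] power_divide of_real_power[symmetric] s)
  also have "of_real (1 + x\<^sup>2) = (1 + \<i> * of_real x) * (1 - \<i> * of_real x)"
    by (simp add: algebra_simps power2_eq_square)
  finally have z: "cis (2 * arctan x + pi) = - ((1 + \<i> * of_real x) / (1 - \<i> * of_real x))"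
    by (simp add: power2_eq_square)
  have "cis (2 * arctan x + pi) - 1 = - 2 / (1 - \<i> * of_real x)"
    "- \<i> * cis (2 * arctan x + pi) - \<i> = - 2 * of_real x / (1 - \<i> * of_real x)"
    unfolding z using nz by (simp_all add: field_simps)
  then show ?thesis
    unfolding cayley_def using nz by (simp add: proj_quot_def)
qed

text \<open>The sixth vertex is the one sent to \<open>\<infinity>\<close>: in the numbering from 1 to 6 it is last, as is the
  parameter \<open>2 \<pi>\<close> that \<open>cayley\<close> sends there.\<close>

lemma negative_cross_ratios_circle:
  assumes w: "has_edge_cross_ratios w T" "has_constant_S w S" and S: "S \<noteq> 0" "S \<noteq> 1"
    and T: "real_negative T" and c: "c \<in> hex_F"
  obtains M where "hexagon_circle w c M"
proof -
  let ?x = "\<lambda>i. w (hex_vertex c i)"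
  have neg: "\<exists>t<0. cross_ratio (?x i) (?x (i + 1)) (?x (i + 2)) (?x (i - 1)) = Fin (of_real t)" for i
  proof -
    obtain j where "hex_edge c i \<in> hex_Ecl j" using hex_edge_class[OF c] by metis
    then have "hex_edge c i \<in> hex_E" unfolding hex_Ecl_def by auto
    then show ?thesis
      using w(1) T c unfolding has_edge_cross_ratios_def real_negative_def edge_cross_ratio_def
      by metis
  qed
  note ne = hexagon_images_distinct[OF w(2) S c]
  have x0: "?x 0 = ?x 6" and x7: "?x 7 = ?x 1" and x8: "?x 8 = ?x 2"
    using hex_vertex_6[of c 0] hex_vertex_6[of c 1] hex_vertex_6[of c 2] by simp_all
  have d: "?x 6 \<noteq> ?x 1" "?x 6 \<noteq> ?x 2" "?x 1 \<noteq> ?x 2"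
    using ne(1)[of 0] ne(2)[of 0] ne(1)[of 1] x0 by simp_all
  obtain N where N: "is_moebius N" "N (?x 6) = Infty" "N (?x 1) = Fin 0" "N (?x 2) = Fin 1"
    using moebius_three_points[OF d, of Infty "Fin 0" "Fin 1"] by auto
  have inv: "\<exists>t<0. cross_ratio (N (?x i)) (N (?x (i + 1))) (N (?x (i + 2))) (N (?x (i - 1)))
      = Fin (of_real t)" for i
    using neg cross_ratio_moebius[OF N(1)] by metis
  obtain t1 t2 t3 t6 :: real where t:
    "cross_ratio Infty (Fin 0) (Fin 1) (N (?x 5)) = Fin (of_real t6)" "t6 < 0"
    "cross_ratio (Fin 0) (Fin 1) (N (?x 3)) Infty = Fin (of_real t1)" "t1 < 0"
    "cross_ratio (Fin 1) (N (?x 3)) (N (?x 4)) (Fin 0) = Fin (of_real t2)" "t2 < 0"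
    "cross_ratio (N (?x 3)) (N (?x 4)) (N (?x 5)) (Fin 1) = Fin (of_real t3)" "t3 < 0"
    using inv[of 6] inv[of 1] inv[of 2] inv[of 3] N x0 x7 x8 by auto
  have "N (?x 3) \<noteq> N (?x 4)" using ne(1)[of 3] is_moebius_inj[OF N(1)] by simp
  then obtain a3 a4 a5 :: real where a: "N (?x 3) = Fin (of_real a3)" "N (?x 4) = Fin (of_real a4)"
      "N (?x 5) = Fin (of_real a5)" "1 < a3" "a3 < a4" "a4 < a5"
    using six_points_in_order[OF t] by metis
  obtain N' where N': "is_moebius N'" "\<And>u. N' (N u) = u"
    using is_moebius_inverse[OF N(1)] by metis
  define y where "y = (\<lambda>k::nat. if k = 1 then 0 else if k = 2 then 1 else if k = 3 then a3
    else if k = 4 then a4 else a5)"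
  define \<theta> where "\<theta> k = (if k = 6 then 2 * pi else 2 * arctan (y k) + pi)" for k
  have x: "N (?x (int k)) = cayley (Fin (cis (\<theta> k)))" if "k \<in> {1..6}" for k
  proof -
    have "k \<in> {1, 2, 3, 4, 5, 6}" using that by auto
    then show ?thesis
      using N a by (auto simp: \<theta>_def y_def cayley_arctan cayley_1)
  qed
  have "hexagon_circle w c (\<lambda>u. N' (cayley u))"
    unfolding hexagon_circle_def
  proof (intro conjI exI[of _ \<theta>] ballI)
    show "is_moebius (\<lambda>u. N' (cayley u))" by (rule is_moebius_compose[OF N'(1) is_moebius_cayley])
    show "\<theta> k < \<theta> (k + 1)" if "k \<in> {1..5}" for k
    proof -
      have "k \<in> {1, 2, 3, 4, 5}" using that by auto
      then show ?thesis
        using a(4-6)[THEN arctan_monotone] arctan_ubound[of a5]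
        by (auto simp: \<theta>_def y_def arctan_one)
    qed
    show "\<theta> 6 < \<theta> 1 + 2 * pi" by (simp add: \<theta>_def y_def)
    show "w (c + \<epsilon> ^ k) = N' (cayley (Fin (cis (\<theta> k))))" if "k \<in> {1..6}" for k
      using x[OF that] N'(2) by (metis hex_vertex_def power_int_of_nat)
  qed
  then show ?thesis using that by blast
qed

section \<open>Intersection angles\<close>

lemma cis_diff: "cis x - cis y = 2 * \<i> * of_real (sin ((x - y) / 2)) * cis ((x + y) / 2)"
proof -
  have "cos x - cos y = - (2 * sin ((x + y) / 2) * sin ((x - y) / 2))"
    using cos_diff_cos[of x y] sin_minus[of "(x - y) / 2"] by (simp add: minus_divide_left)
  moreover have "sin x - sin y = 2 * sin ((x - y) / 2) * cos ((x + y) / 2)"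
    by (rule sin_diff_sin)
  ultimately show ?thesis by (simp add: complex_eq_iff)
qed

text \<open>On the unit circle, \<open>(u2 - u1) (u3 - u2) / (u3 - u1)\<close> is a positive multiple of the tangent
  vector \<open>\<i> u2\<close>, by \<open>cis_diff\<close>; positivity is where the order of the three angles enters. The Moebius
  transformation multiplies both vectors by its derivative at \<open>u2\<close>: in the quotient of \<open>sdiff\<close>
  terms the scaling factors of \<open>u1\<close> and \<open>u3\<close> cancel.\<close>

lemma moebius_circle_derivative:
  assumes M: "is_moebius M" and \<theta>: "\<theta>1 < \<theta>2" "\<theta>2 < \<theta>3" "\<theta>3 < \<theta>1 + 2 * pi"
    and p: "M (Fin (cis \<theta>2)) \<noteq> Infty"
  defines "A \<equiv> M (Fin (cis \<theta>1))" and "P \<equiv> M (Fin (cis \<theta>2))" and "B \<equiv> M (Fin (cis \<theta>3))"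
  obtains r :: real where "r > 0" "\<And>\<tau>. cis \<tau> = cis \<theta>2 \<Longrightarrow>
    ((\<lambda>t. affine (M (Fin (cis t)))) has_vector_derivative
      of_real r * (sdiff P A * sdiff B P / sdiff B A)) (at \<tau>)"
proof -
  obtain a b c d where d: "a * d - b * c \<noteq> 0" "M = moebius_map a b c d"
    using M unfolding is_moebius_def by metis
  let ?D = "a * d - b * c"
  let ?u1 = "cis \<theta>1" and ?u2 = "cis \<theta>2" and ?u3 = "cis \<theta>3"
  obtain k where k: "\<And>u. k u \<noteq> 0" "\<And>u. c * num u + d * den u = k u * den (M u)"
    and sd: "\<And>u v. ?D * sdiff u v = k u * k v * sdiff (M u) (M v)"
    using moebius_map_sdiff[OF d(1)] unfolding d(2) by metis
  let ?k1 = "k (Fin ?u1)" and ?k2 = "k (Fin ?u2)" and ?k3 = "k (Fin ?u3)"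
  have "den (M (Fin ?u2)) = 1" using p by (cases "M (Fin ?u2)") auto
  then have k2: "c * ?u2 + d = ?k2" using k(2)[of "Fin ?u2"] by simp
  define s where "s = sin ((\<theta>2 - \<theta>1) / 2) * sin ((\<theta>3 - \<theta>2) / 2) / sin ((\<theta>3 - \<theta>1) / 2)"
  have s_pos: "sin ((\<theta>2 - \<theta>1) / 2) > 0" "sin ((\<theta>3 - \<theta>2) / 2) > 0" "sin ((\<theta>3 - \<theta>1) / 2) > 0"
    using \<theta> by (auto intro!: sin_gt_zero)
  then have s: "s > 0" by (simp add: s_def)
  have "cis ((\<theta>2 + \<theta>1) / 2) * cis ((\<theta>3 + \<theta>2) / 2) = cis ((\<theta>3 + \<theta>1) / 2) * ?u2"
    by (simp add: cis_mult add_divide_distrib ac_simps)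
  then have "(?u2 - ?u1) * (?u3 - ?u2) =
      (2 * \<i>)\<^sup>2 * of_real (sin ((\<theta>2 - \<theta>1) / 2) * sin ((\<theta>3 - \<theta>2) / 2)) * (cis ((\<theta>3 + \<theta>1) / 2) * ?u2)"
    unfolding cis_diff[of \<theta>2 \<theta>1] cis_diff[of \<theta>3 \<theta>2] by (simp add: power2_eq_square mult.assoc mult.left_commute)
  also have "of_real (sin ((\<theta>2 - \<theta>1) / 2) * sin ((\<theta>3 - \<theta>2) / 2)) =
      (of_real (s * sin ((\<theta>3 - \<theta>1) / 2)) :: complex)"
    using s_pos by (simp add: s_def)
  also have "(2 * \<i>)\<^sup>2 * of_real (s * sin ((\<theta>3 - \<theta>1) / 2)) * (cis ((\<theta>3 + \<theta>1) / 2) * ?u2) =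
      2 * \<i> * of_real s * ?u2 * (?u3 - ?u1)"
    unfolding cis_diff[of \<theta>3 \<theta>1] by (simp add: power2_eq_square mult.assoc mult.left_commute)
  finally have u: "(?u2 - ?u1) * (?u3 - ?u2) = 2 * \<i> * of_real s * ?u2 * (?u3 - ?u1)" .
  have u13: "?u3 - ?u1 \<noteq> 0" unfolding cis_diff using s_pos by simp
  have "sdiff P A * sdiff B P / sdiff B A = 2 * of_real s * (?u2 * \<i> * ?D / ?k2\<^sup>2)"
  proof -
    have PA: "sdiff P A = ?D * (?u2 - ?u1) / (?k2 * ?k1)" and BP: "sdiff B P = ?D * (?u3 - ?u2) / (?k3 * ?k2)"
      and BA: "sdiff B A = ?D * (?u3 - ?u1) / (?k3 * ?k1)"
      using sd[of "Fin ?u2" "Fin ?u1"] sd[of "Fin ?u3" "Fin ?u2"] sd[of "Fin ?u3" "Fin ?u1"] k(1)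
      unfolding A_def B_def P_def by (simp_all add: field_simps)
    have "sdiff P A * sdiff B P / sdiff B A =
        ?D * ((?u2 - ?u1) * (?u3 - ?u2)) / (?k2\<^sup>2 * (?u3 - ?u1))"
      unfolding PA BP BA using k(1) d(1) u13 by (simp add: power2_eq_square ac_simps)
    then show ?thesis unfolding u using u13 by simp
  qed
  then have eq: "?u2 * \<i> * (?D / ?k2\<^sup>2) = of_real (1 / (2 * s)) * (sdiff P A * sdiff B P / sdiff B A)"
    using s by simp
  show ?thesis
  proof
    show "1 / (2 * s) > 0" using s by simp
    fix \<tau> assume \<tau>: "cis \<tau> = cis \<theta>2"
    have nz: "c * cis \<tau> + d \<noteq> 0" using k2 k(1) \<tau> by metis
    have g: "((\<lambda>z. (a * z + b) / (c * z + d)) has_field_derivative ?D / ?k2\<^sup>2) (at (cis \<tau>))"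
      unfolding k2[symmetric] unfolding \<tau>[symmetric] using nz
      by (auto intro!: derivative_eq_intros simp: power2_eq_square algebra_simps)
    have "(cis has_vector_derivative \<i> * cis \<tau>) (at \<tau>)"
      using has_derivative_cis[of "\<lambda>t. t" "\<lambda>t. t" \<tau> UNIV] 
      by (simp add: has_vector_derivative_def mult.commute)
    from field_vector_diff_chain_at[OF this g]
    have "((\<lambda>t. (a * cis t + b) / (c * cis t + d)) has_vector_derivative
        \<i> * cis \<tau> * (?D / ?k2\<^sup>2)) (at \<tau>)"
      by (simp add: o_def)
    then have "((\<lambda>t. affine (M (Fin (cis t)))) has_vector_derivative \<i> * cis \<tau> * (?D / ?k2\<^sup>2)) (at \<tau>)"
    proof (rule has_vector_derivative_transform_within_open)
      have "continuous_on UNIV (\<lambda>t. c * cis t + d)" by (intro continuous_intros)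
      then show "open {t. c * cis t + d \<noteq> 0}"
        by (intro open_Collect_neq) (auto intro: continuous_intros)
      show "\<tau> \<in> {t. c * cis t + d \<noteq> 0}" using nz by simp
      show "(a * cis t + b) / (c * cis t + d) = affine (M (Fin (cis t)))"
        if "t \<in> {t. c * cis t + d \<noteq> 0}" for t
        using that by (simp add: d(2) proj_quot_def)
    qed
    then show "((\<lambda>t. affine (M (Fin (cis t)))) has_vector_derivative
      of_real (1 / (2 * s)) * (sdiff P A * sdiff B P / sdiff B A)) (at \<tau>)"
      unfolding eq[symmetric] \<tau> by (simp add: mult.commute)
  qed
qed

text \<open>The Moebius transformation behind \<open>chart_at\<close>.\<close>

definition chart :: "csphere \<Rightarrow> csphere \<Rightarrow> csphere" where
  "chart p = (if p = Infty then moebius_map 0 1 1 0 else (\<lambda>z. z))"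

lemma is_moebius_chart: "is_moebius (chart p)"
proof -
  have "is_moebius (moebius_map 0 1 1 0)"
    unfolding is_moebius_def
    by (rule exI[of _ 0], rule exI[of _ 1], rule exI[of _ 1], rule exI[of _ 0]) simp
  then show ?thesis using is_moebius_id by (simp add: chart_def)
qed

lemma circle_tangent_formula:
  assumes M: "is_moebius M" and \<theta>: "\<theta>1 < \<theta>2" "\<theta>2 < \<theta>3" "\<theta>3 < \<theta>1 + 2 * pi"
    and p: "a = M (Fin (cis \<theta>1))" "p = M (Fin (cis \<theta>2))" "b = M (Fin (cis \<theta>3))"
  obtains r :: real where "r > 0" "circle_tangent M p =
    of_real r * (sdiff (chart p p) (chart p a) * sdiff (chart p b) (chart p p) /
      sdiff (chart p b) (chart p a))"
proof -
  have "chart p p \<noteq> Infty" by (simp add: chart_def proj_quot_def)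
  then obtain r :: real where r: "r > 0" "\<And>\<tau>. cis \<tau> = cis \<theta>2 \<Longrightarrow>
    ((\<lambda>t. affine (chart p (M (Fin (cis t))))) has_vector_derivative
      of_real r * (sdiff (chart p p) (chart p a) * sdiff (chart p b) (chart p p) /
      sdiff (chart p b) (chart p a))) (at \<tau>)"
    using moebius_circle_derivative[OF is_moebius_compose[OF is_moebius_chart M] \<theta>, of p]
    unfolding p by metis
  define \<tau> where "\<tau> = (SOME t. M (Fin (cis t)) = p)"
  have "M (Fin (cis \<tau>)) = p"
    unfolding \<tau>_def by (rule someI[of _ \<theta>2]) (simp add: p)
  then have "cis \<tau> = cis \<theta>2" using is_moebius_inj[OF M] p by auto
  moreover have "chart_at p z = affine (chart p z)" for z
    by (simp add: chart_at_def chart_def)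
  ultimately have "circle_tangent M p =
    of_real r * (sdiff (chart p p) (chart p a) * sdiff (chart p b) (chart p p) /
      sdiff (chart p b) (chart p a))"
    unfolding circle_tangent_def \<tau>_def[symmetric] using vector_derivative_at[OF r(2)] by simp
  then show ?thesis using that r(1) by blast
qed

text \<open>The six parameters are continued by one more on each side, \<open>\<theta> 6 - 2 \<pi>\<close> and \<open>\<theta> 1 + 2 \<pi>\<close>, so that
  every vertex has parameters of both its neighbours around its own.\<close>

lemma hexagon_circle_consecutive:
  assumes "hexagon_circle w c M"
  obtains \<theta>1 \<theta>2 \<theta>3 where "\<theta>1 < \<theta>2" "\<theta>2 < \<theta>3" "\<theta>3 < \<theta>1 + 2 * pi"
    "w (hex_vertex c (i - 1)) = M (Fin (cis \<theta>1))" "w (hex_vertex c i) = M (Fin (cis \<theta>2))"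
    "w (hex_vertex c (i + 1)) = M (Fin (cis \<theta>3))"
proof -
  obtain \<theta> :: "nat \<Rightarrow> real" where \<theta>: "\<forall>k\<in>{1..5}. \<theta> k < \<theta> (k + 1)" "\<theta> 6 < \<theta> 1 + 2 * pi"
    "\<forall>k\<in>{1..6}. w (c + \<epsilon> ^ k) = M (Fin (cis (\<theta> k)))"
    using assms unfolding hexagon_circle_def by blast
  have "\<theta> 1 < \<theta> 2" using \<theta>(1)[rule_format, of 1] by (simp add: numeral_2_eq_2)
  then have inc: "\<theta> 1 < \<theta> 2" "\<theta> 2 < \<theta> 3" "\<theta> 3 < \<theta> 4" "\<theta> 4 < \<theta> 5" "\<theta> 5 < \<theta> 6"
    using \<theta>(1)[rule_format, of 2] \<theta>(1)[rule_format, of 3]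
      \<theta>(1)[rule_format, of 4] \<theta>(1)[rule_format, of 5] by simp_all
  define \<Theta> where "\<Theta> n = (if n = 0 then \<theta> 6 - 2 * pi else if n = 7 then \<theta> 1 + 2 * pi else \<theta> n)" for n
  have eps6: "\<epsilon> ^ 6 = 1" using eps_powi_add(6)[of 0] by simp
  have cis_period: "cis (x + 2 * pi) = cis x" "cis (x - 2 * pi) = cis x" for x
    by (simp_all add: complex_eq_iff cos_diff sin_diff)
  have w: "w (c + \<epsilon> ^ n) = M (Fin (cis (\<Theta> n)))" if "n \<le> 7" for n
  proof -
    have "n = 0 \<or> n = 7 \<or> n \<in> {1..6}" using that by auto
    then consider "n = 0" | "n = 7" | "n \<in> {1..6}" by blast
    then show ?thesis
    proof cases
      case 1
      then show ?thesis
        using \<theta>(3)[rule_format, of 6] eps6 by (simp add: \<Theta>_def cis_period)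
    next
      case 2
      have "\<epsilon> ^ 7 = \<epsilon>" using eps6 by (simp add: eval_nat_numeral)
      with 2 show ?thesis
        using \<theta>(3)[rule_format, of 1] by (simp add: \<Theta>_def cis_period)
    next
      case 3
      then show ?thesis using \<theta>(3) by (auto simp: \<Theta>_def)
    qed
  qed
  define n where "n = nat ((i - 1) mod 6)"
  have n: "n \<in> {0, 1, 2, 3, 4, 5}" unfolding n_def by (rule mod_6_cases[of "i - 1"]) simp_all
  have "\<epsilon> powi (i - 1) = \<epsilon> ^ n"
    unfolding n_def using eps_powi_mod[of "i - 1"] power_int_of_nat[of \<epsilon> "nat ((i - 1) mod 6)"] by simp
  moreover have "\<epsilon> powi i = \<epsilon> powi (i - 1) * \<epsilon>" "\<epsilon> powi (i + 1) = \<epsilon> powi i * \<epsilon>"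
    using power_int_add_1[of \<epsilon> "i - 1"] power_int_add_1[of \<epsilon> i] by simp_all
  ultimately have v: "hex_vertex c (i - 1) = c + \<epsilon> ^ n" "hex_vertex c i = c + \<epsilon> ^ (n + 1)"
    "hex_vertex c (i + 1) = c + \<epsilon> ^ (n + 2)"
    unfolding hex_vertex_def by (simp_all add: mult.commute)
  show ?thesis
  proof
    show "\<Theta> n < \<Theta> (n + 1)" "\<Theta> (n + 1) < \<Theta> (n + 2)" "\<Theta> (n + 2) < \<Theta> n + 2 * pi"
      using n inc \<theta>(2) by (auto simp: \<Theta>_def numeral_eq_Suc)
  qed (use w[of n] w[of "n + 1"] w[of "n + 2"] n in \<open>auto simp: v\<close>)
qed

lemma abs_Arg_inverse: "\<bar>Arg (inverse z)\<bar> = \<bar>Arg z\<bar>"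
  by (simp add: Arg_inverse)

lemma abs_Arg_divide_swap: "\<bar>Arg (x / y)\<bar> = \<bar>Arg (y / x)\<bar>"
  using abs_Arg_inverse[of "x / y"] by simp

text \<open>The first circle runs through \<open>a, p, q\<close> and the second through \<open>q, p, b\<close>. The quotient of the
  tangent vectors \<open>(p - a) (q - p) / (q - a)\<close> and \<open>(p - q) (b - p) / (b - q)\<close> is \<open>-1 / \<sigma>\<close>, and
  inverting a complex number preserves the modulus of its argument.\<close>

lemma circle_angle:
  assumes S: "cross_ratio q a p b = Fin \<sigma>" "\<sigma> \<noteq> 0" "\<sigma> \<noteq> 1"
    and M: "is_moebius M" "\<theta>1 < \<theta>2" "\<theta>2 < \<theta>3" "\<theta>3 < \<theta>1 + 2 * pi"
      "a = M (Fin (cis \<theta>1))" "p = M (Fin (cis \<theta>2))" "q = M (Fin (cis \<theta>3))"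
    and M': "is_moebius M'" "\<theta>1' < \<theta>2'" "\<theta>2' < \<theta>3'" "\<theta>3' < \<theta>1' + 2 * pi"
      "q = M' (Fin (cis \<theta>1'))" "p = M' (Fin (cis \<theta>2'))" "b = M' (Fin (cis \<theta>3'))"
  shows "intersection_angle M M' p = \<bar>Arg (- \<sigma>)\<bar>"
proof -
  let ?s = "\<lambda>x y. sdiff (chart p x) (chart p y)"
  obtain r where r: "r > 0" "circle_tangent M p = of_real r * (?s p a * ?s q p / ?s q a)"
    by (rule circle_tangent_formula[OF M])
  obtain r' where r': "r' > 0" "circle_tangent M' p = of_real r' * (?s p q * ?s b p / ?s b q)"
    by (rule circle_tangent_formula[OF M'])
  have cr: "cross_ratio (chart p q) (chart p a) (chart p p) (chart p b) = Fin \<sigma>"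
    using S(1) cross_ratio_moebius[OF is_moebius_chart] by simp
  then have "?s a q * ?s b p = \<sigma> * (?s p a * ?s q b)"
    by (simp add: cross_ratio_eq_Fin_iff)
  then have eq: "?s q a * ?s b p = \<sigma> * (?s p a * ?s b q)"
    using sdiff_swap[of "chart p a" "chart p q"] sdiff_swap[of "chart p q" "chart p b"] by simp
  note d = cross_ratio_all_distinct[OF cr S(2,3)]
  have nz: "?s p a \<noteq> 0" "?s q p \<noteq> 0" "?s q a \<noteq> 0" "?s b p \<noteq> 0" "?s b q \<noteq> 0"
    using d by auto
  have "circle_tangent M p / circle_tangent M' p =
      of_real (r / r') * ((?s p a * ?s b q) * ?s q p / ((?s q a * ?s b p) * ?s p q))"
    unfolding r r' using nz r(1) r'(1) by (simp add: ac_simps)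
  also have "\<dots> = of_real (r / r') * inverse (- \<sigma>)"
    unfolding eq sdiff_swap[of "chart p p" "chart p q"] using nz S(2) by (simp add: field_simps)
  finally have "Arg (circle_tangent M p / circle_tangent M' p) = Arg (inverse (- \<sigma>))"
    using Arg_times_of_real[of "r / r'" "inverse (- \<sigma>)"] r(1) r'(1) by simp
  then show ?thesis
    unfolding intersection_angle_def using abs_Arg_inverse by metis
qed

text \<open>Adjacent hexagons run through their common edge in opposite directions, so the situation at its
  second end is that at the first with the two hexagons exchanged.\<close>

lemma constant_S_constant_angles:
  assumes w: "has_constant_S w S" and S: "S \<noteq> 0" "S \<noteq> 1"
  shows "constant_angles w"
proof -
  have half: "intersection_angle M M' (w (hex_vertex c i)) = \<bar>Arg (- class_S S j)\<bar>"
    if j: "j \<in> {1, 2, 3}" "hex_edge c i \<in> hex_Ecl j"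
      and opp: "c' = c + \<epsilon> powi i * (2 + \<omega>)" "\<epsilon> powi i' = - (\<epsilon> powi i)"
      and M: "hexagon_circle w c M" "hexagon_circle w c' M'" for j c i c' i' M M'
  proof -
    note v = opposite_hexagon_vertices[OF opp]
    have mo: "is_moebius M" "is_moebius M'" using M unfolding hexagon_circle_def by auto
    obtain \<theta>1 \<theta>2 \<theta>3 where \<theta>: "\<theta>1 < \<theta>2" "\<theta>2 < \<theta>3" "\<theta>3 < \<theta>1 + 2 * pi"
      "w (hex_vertex c (i - 1)) = M (Fin (cis \<theta>1))" "w (hex_vertex c i) = M (Fin (cis \<theta>2))"
      "w (hex_vertex c (i + 1)) = M (Fin (cis \<theta>3))"
      by (rule hexagon_circle_consecutive[OF M(1)])
    obtain \<theta>1' \<theta>2' \<theta>3' where \<theta>': "\<theta>1' < \<theta>2'" "\<theta>2' < \<theta>3'" "\<theta>3' < \<theta>1' + 2 * pi"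
      "w (hex_vertex c (i + 1)) = M' (Fin (cis \<theta>1'))" "w (hex_vertex c i) = M' (Fin (cis \<theta>2'))"
      "w (c + 2 * \<epsilon> powi i) = M' (Fin (cis \<theta>3'))"
      using hexagon_circle_consecutive[OF M(2), of "i' + 1"] v by (auto simp: add.assoc)
    show ?thesis
      by (rule circle_angle[OF spoke_cross_ratio[OF w S j] class_S_nontrivial[OF S] mo(1) \<theta> mo(2) \<theta>'])
  qed
  show ?thesis
    unfolding constant_angles_def
  proof (rule exI[of _ "\<lambda>j. \<bar>Arg (- class_S S j)\<bar>"], intro ballI allI impI)
    fix j :: nat and e c c' i i' M M' z
    assume j: "j \<in> {1, 2, 3}" and e: "e \<in> hex_Ecl j" and c: "c \<noteq> c' \<and> hex_edge c i = e \<and> hex_edge c' i' = e"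
      and M: "hexagon_circle w c M \<and> hexagon_circle w c' M'" and z: "z \<in> e"
    have opp: "c' = c + \<epsilon> powi i * (2 + \<omega>)" "\<epsilon> powi i' = - (\<epsilon> powi i)"
      using hex_edge_eqD[of c i c' i'] c by auto
    have opp': "c = c' + \<epsilon> powi i' * (2 + \<omega>)" "\<epsilon> powi i = - (\<epsilon> powi i')"
      unfolding opp by simp_all
    have ij: "hex_edge c i \<in> hex_Ecl j" "hex_edge c' i' \<in> hex_Ecl j" using e c by auto
    have "z = hex_vertex c i \<or> z = hex_vertex c' i'"
      using z c opposite_hexagon_vertices(2)[OF opp] unfolding hex_edge_def by auto
    then show "intersection_angle M M' (w z) = \<bar>Arg (- class_S S j)\<bar>"
    proof
      assume "z = hex_vertex c i"
      then show ?thesis using half[OF j ij(1) opp] M by simp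
    next
      assume "z = hex_vertex c' i'"
      then have "intersection_angle M' M (w z) = \<bar>Arg (- class_S S j)\<bar>"
        using half[OF j ij(2) opp'] M by simp
      then show ?thesis unfolding intersection_angle_def using abs_Arg_divide_swap by metis
    qed
  qed
qed

section \<open>Maps with constant S and solutions of the hexagon relation\<close>

theorem theorem4p4:
  fixes S :: complex
  assumes "S \<noteq> 0" and "S \<noteq> 1"
  shows "(\<forall>w :: complex \<Rightarrow> csphere. has_constant_S w S \<longrightarrow>
            (\<exists>T. has_edge_cross_ratios w T \<and> solves_hex T)) \<and>
         (\<forall>T. solves_hex T \<longrightarrow>
            (\<exists>w. has_edge_cross_ratios w T \<and> has_constant_S w S \<and>
                 (\<forall>w'. has_edge_cross_ratios w' T \<and> has_constant_S w' S \<longleftrightarrow>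
                        (\<exists>M. is_moebius M \<and> (\<forall>z\<in>hex_V. w' z = M (w z))))) \<and>
            (real_negative T \<longrightarrow>
               (\<forall>w. has_edge_cross_ratios w T \<and> has_constant_S w S \<longrightarrow>
                     circle_pattern w \<and> constant_angles w)))"
proof (intro conjI allI impI)
  fix w :: "complex \<Rightarrow> csphere" assume "has_constant_S w S"
  then show "\<exists>T. has_edge_cross_ratios w T \<and> solves_hex T"
    using constant_S_edge_cross_ratios assms by metis
next
  fix T assume T: "solves_hex T"
  obtain w where w: "has_edge_cross_ratios w T" "has_constant_S w S"
    using constant_S_map_exists[OF T assms] .
  have "has_edge_cross_ratios w' T \<and> has_constant_S w' S \<longleftrightarrow>
      (\<exists>M. is_moebius M \<and> (\<forall>z\<in>hex_V. w' z = M (w z)))" for w'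
    using constant_S_map_unique[OF T assms w] moebius_preserves w by metis
  with w show "\<exists>w. has_edge_cross_ratios w T \<and> has_constant_S w S \<and>
      (\<forall>w'. has_edge_cross_ratios w' T \<and> has_constant_S w' S \<longleftrightarrow>
        (\<exists>M. is_moebius M \<and> (\<forall>z\<in>hex_V. w' z = M (w z))))"
    by blast
next
  fix T w assume "real_negative T" "has_edge_cross_ratios w T \<and> has_constant_S w S"
  then show "circle_pattern w"
    unfolding circle_pattern_def using negative_cross_ratios_circle assms by metis
next
  fix T w assume "has_edge_cross_ratios w T \<and> has_constant_S w S"
  then show "constant_angles w" using constant_S_constant_angles assms by blast
qed

end
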